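(* Let $N\ge 1$ be an integer, $p>1$, $q=\frac{2p}{p+1}$, and let $M\ge M_0$, where $$M_0:=\left(6N(p+1)\right)^{\frac{p}{p+1}}\left(\frac{p+1}{p-1}\right)^{1/2}.$$ Let $u$ be a nonnegative solution of $$u_t-\Delta u=u^p+M|\nabla u|^q\quad\text{in }\mathbb{R}^N\times(-\infty,0)$$ which satisfies $u_t\le 0$ in $\mathbb{R}^N\times(-\infty,0)$ and $$u(x,t)=o\left(|x|+|t|^{\frac{p+1}{2p}}\right)\quad\text{as } |x|+|t|^{\frac{p+1}{2p}}\to\infty.$$ Then $u\equiv 0$. In particular, any bounded nonnegative solution of this equation in $\mathbb{R}^N\times(-\infty,0)$ with $u_t\le 0$ is $u\equiv 0$.
   Context: The operators $\nabla$ and $\Delta$ act only on the spatial variable $x$. A solution is a classical solution, i.e. it belongs to $C^{2,1}(\mathbb{R}^N\times(-\infty,0))$ ($C^2$ in $x$, $C^1$ in $t$). *)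

theory Defs
  imports "HOL-Analysis.Analysis" "HOL-Library.Landau_Symbols"
begin

text \<open>
  The space \<open>\<real>\<^sup>N\<close> is a Euclidean space \<open>'a\<close> with \<open>N = DIM('a)\<close>, so that \<open>N \<ge> 1\<close> is automatic.
  A function on \<open>\<real>\<^sup>N \<times> (-\<infinity>,0)\<close> is a curried function \<open>u x t\<close>; its values for
  \<open>t \<ge> 0\<close> are irrelevant and never constrained.
\<close>

definition past :: "('a::euclidean_space \<times> real) set" where
  "past = UNIV \<times> {..<0}"

definition partially_differentiable :: "'a::euclidean_space \<Rightarrow> ('a \<Rightarrow> real) \<Rightarrow> 'a \<Rightarrow> bool" where
  "partially_differentiable i f x \<longleftrightarrow> (\<lambda>s. f (x + s *\<^sub>R i)) differentiable (at 0)"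

definition partial :: "'a::euclidean_space \<Rightarrow> ('a \<Rightarrow> real) \<Rightarrow> 'a \<Rightarrow> real" where
  "partial i f x = deriv (\<lambda>s. f (x + s *\<^sub>R i)) 0"

definition gradient :: "('a::euclidean_space \<Rightarrow> real) \<Rightarrow> 'a \<Rightarrow> 'a" where
  "gradient f x = (\<Sum>i\<in>Basis. partial i f x *\<^sub>R i)"

definition laplacian :: "('a::euclidean_space \<Rightarrow> real) \<Rightarrow> 'a \<Rightarrow> real" where
  "laplacian f x = (\<Sum>i\<in>Basis. partial i (partial i f) x)"

definition time_deriv :: "('a::euclidean_space \<Rightarrow> real \<Rightarrow> real) \<Rightarrow> 'a \<Rightarrow> real \<Rightarrow> real" where
  "time_deriv u x t = deriv (u x) t"

text \<open>
  \<open>C\<^sup>2\<^sup>,\<^sup>1\<close> on \<open>\<real>\<^sup>N \<times> (-\<infinity>,0)\<close>: the function, its time derivative and its spatial partial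
  derivatives of order one and two exist and are jointly continuous in \<open>(x,t)\<close>.
\<close>

definition C21 :: "('a::euclidean_space \<Rightarrow> real \<Rightarrow> real) \<Rightarrow> bool" where
  "C21 u \<longleftrightarrow>
     continuous_on past (\<lambda>(x, t). u x t) \<and>
     (\<forall>x. \<forall>t<0. u x differentiable (at t)) \<and>
     continuous_on past (\<lambda>(x, t). time_deriv u x t) \<and>
     (\<forall>i\<in>Basis.
        (\<forall>x. \<forall>t<0. partially_differentiable i (\<lambda>y. u y t) x) \<and>
        continuous_on past (\<lambda>(x, t). partial i (\<lambda>y. u y t) x)) \<and>
     (\<forall>i\<in>Basis. \<forall>j\<in>Basis.
        (\<forall>x. \<forall>t<0. partially_differentiable j (partial i (\<lambda>y. u y t)) x) \<and>
        continuous_on past (\<lambda>(x, t). partial j (partial i (\<lambda>y. u y t)) x))"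

text \<open>
  Classical solutions of \<open>u\<^sub>t - \<Delta>u = u\<^sup>p + M |\<nabla>u|\<^sup>q\<close>. The real power \<open>u\<^sup>p\<close> is only meant for
  \<open>u \<ge> 0\<close>; nonnegativity is imposed separately.
\<close>

definition classical_solution ::
    "real \<Rightarrow> real \<Rightarrow> real \<Rightarrow> ('a::euclidean_space \<Rightarrow> real \<Rightarrow> real) \<Rightarrow> bool" where
  "classical_solution p q M u \<longleftrightarrow>
     C21 u \<and>
     (\<forall>x. \<forall>t<0. time_deriv u x t - laplacian (\<lambda>y. u y t) x =
        u x t powr p + M * norm (gradient (\<lambda>y. u y t) x) powr q)"

definition M0 :: "nat \<Rightarrow> real \<Rightarrow> real" where
  "M0 N p = (6 * real N * (p + 1)) powr (p / (p + 1)) * ((p + 1) / (p - 1)) powr (1 / 2)"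

definition parabolic_size :: "real \<Rightarrow> 'a::euclidean_space \<times> real \<Rightarrow> real" where
  "parabolic_size p = (\<lambda>(x, t). norm x + \<bar>t\<bar> powr ((p + 1) / (2 * p)))"

text \<open>
  The limit \<open>|x| + |t|\<^bsup>(p+1)/(2p)\<^esup> \<rightarrow> \<infinity>\<close> with \<open>(x,t)\<close> restricted to \<open>\<real>\<^sup>N \<times> (-\<infinity>,0)\<close>.
\<close>

definition parabolic_infinity :: "real \<Rightarrow> ('a::euclidean_space \<times> real) filter" where
  "parabolic_infinity p = inf (filtercomap (parabolic_size p) at_top) (principal past)"

end

theory Submission
  imports Defs
begin

text \<open>
  Fix \<open>x\<^sub>0\<close>, \<open>t\<^sub>0\<close>, \<open>R\<close>, let \<open>e = 1 - (|x - x\<^sub>0|\<^sup>2 + t\<^sub>0 - t)/R\<^sup>2\<close> and maximise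
  \<open>e\<^sup>m (u(x,t) - u(y,t)) / |x - y|\<^sup>1\<^sup>/\<^sup>2\<close> over \<open>x\<close>, \<open>y\<close> and \<open>t \<le> t\<^sub>0\<close> with \<open>e > 0\<close>, where
  \<open>m = 2/(p-1) + 1/2\<close>. This doubling of variables replaces Bernstein's estimate of \<open>|\<nabla>u|\<^sup>2\<close>,
  which would need third derivatives of \<open>u\<close>. Up to terms caused by the cutoff \<open>e\<close>, at a maximum
  both gradients have the same norm \<open>P = w/(2r)\<close>, where \<open>r = |x - y|\<close> and
  \<open>w = u(x,t) - u(y,t)\<close>. Moving \<open>x\<close> by \<open>(1+c) s i\<close> while \<open>y\<close> moves by \<open>s i\<close>, for every basis vector
  \<open>i\<close>, gives \<open>(1+c)\<^sup>2 \<Delta>u(x) - \<Delta>u(y) \<le> c\<^sup>2 N P/r\<close>. As \<open>u\<^sub>t \<le> 0\<close>, we have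
  \<open>-\<Delta>u \<ge> u\<^sup>p + M|\<nabla>u|\<^sup>q\<close> at both points. The choice \<open>c = -1\<close> then yields \<open>M P\<^sup>q \<le> N P/r\<close>, and the
  optimal \<open>c\<close> yields \<open>E\<^sup>2 \<le> (E + N P/r) (u(x)\<^sup>p - u(y)\<^sup>p)\<close> with \<open>E = u(x)\<^sup>p + M P\<^sup>q\<close>. For
  \<open>M \<ge> M\<^sub>0\<close> these two inequalities are incompatible with a definite margin, so the cutoff terms
  cannot be negligible, that is, \<open>E\<^bsup>(p-1)/(2p)\<^esup> \<le> C/(R e)\<close> at the maximum. By the choice of \<open>m\<close>, this bounds
  the maximum by \<open>C R\<^bsup>-m\<^esup>\<close>. Letting \<open>R \<rightarrow> \<infinity>\<close> shows that \<open>u\<close> does not depend on \<open>x\<close>, so \<open>u\<^sub>t = u\<^sup>p \<ge> 0\<close>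
  and hence \<open>u = 0\<close>.
\<close>

section \<open>Incompatibility of the inequalities at a maximum\<close>

lemma powr_diff_le:
  fixes a b s :: real
  assumes "0 \<le> b" "b \<le> a" "a \<le> 1" "1 \<le> s"
  shows "a powr s - b powr s \<le> s * (a - b)"
proof (cases "b = 0 \<or> a = b")
  case True
  have "a powr s \<le> a" using assms powr_le1 powr_mono'[of 1 s a] by (cases "a = 0") auto
  also have "\<dots> \<le> s * a" using assms mult_right_mono[of 1 s a] by simp
  finally show ?thesis using True by auto
next
  case False
  then have b: "0 < b" "b < a" using assms by auto
  have "\<And>x. b \<le> x \<Longrightarrow> x \<le> a \<Longrightarrow> ((\<lambda>z. z powr s) has_real_derivative s * x powr (s - 1)) (at x)"
    using b by (auto intro!: derivative_eq_intros)
  from MVT2[OF b(2) this] obtain z where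
    z: "b < z" "z < a" "a powr s - b powr s = (a - b) * (s * z powr (s - 1))" by auto
  have "z powr (s - 1) \<le> 1" using z b assms by (intro powr_le1) auto
  then have "(a - b) * (s * z powr (s - 1)) \<le> (a - b) * (s * 1)"
    using b assms by (intro mult_left_mono) auto
  with z show ?thesis by (simp add: algebra_simps)
qed

text \<open>In units with \<open>E = 1\<close>, both \<open>U\<close> and \<open>\<mu> * G\<close>
  are at most 1, where \<open>\<mu> = M powr (1 / q)\<close>. With
  \<open>\<kappa> = N * P / r\<close>, the product of \<open>1 + \<kappa>\<close> and
  \<open>U - V\<close> is at most 0.7/(p+1). Hence the leading term of \<open>main\<close> is at
  most 7/10, and the smallness of \<open>A\<close> and \<open>B\<close> keeps the whole right-hand
  side of \<open>main\<close> below 1.\<close>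

lemma touching_inequality_fails_normalized:
  fixes p q M N U V G P r A B :: real
  assumes p: "p > 1" and q: "q = 2 * p / (p + 1)" and N: "N \<ge> 1" and M: "M > 0"
    and Mbig: "(M powr (1 / q))\<^sup>2 \<ge> 6 * N * (p + 1)"
    and UV: "0 \<le> V" "V \<le> U" and G: "0 \<le> G" and P: "0 < P" and r: "0 < r"
    and A: "0 \<le> A" and B: "0 \<le> B"
    and E: "U powr p + M * G powr q = 1"
    and w: "U - V = 2 * P * r" and GP: "\<bar>G - P\<bar> \<le> (U - V) * A"
    and y: "M * P powr q \<le> N * P / r"
    and main: "1 \<le> (1 + N * P / r) * (U powr p - V powr p + M * (G powr q - P powr q) + (U - V) * B)
                 + 2 * P * A"
    and small: "50 * (M powr (1 / q)) * A \<le> 1" "20 * B \<le> 1"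
  shows False
proof -
  define \<mu> where "\<mu> = M powr (1 / q)"
  define \<kappa> where "\<kappa> = N * P / r"
  define w where "w = U - V"
  have q1: "1 < q" "q < 2" using p unfolding q by (auto simp: field_simps)
  have \<mu>: "\<mu> > 0" and \<mu>2: "\<mu>\<^sup>2 \<ge> 6 * N * (p + 1)" using M Mbig unfolding \<mu>_def by auto
  have \<mu>q: "\<mu> powr q = M" using q1 M unfolding \<mu>_def by (simp add: powr_powr)
  have MG: "M * g powr q = (\<mu> * g) powr q" if "g \<ge> 0" for g
    using that \<mu> by (simp add: powr_mult \<mu>q)
  have \<kappa>: "\<kappa> > 0" using N P r unfolding \<kappa>_def by simp
  have "U powr p \<le> 1" using E M by (smt (verit) mult_nonneg_nonneg powr_ge_zero)
  then have U1: "U \<le> 1" using p UV by (smt (verit) gr_one_powr)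
  have "(\<mu> * G) powr q \<le> 1" using E MG[OF G] by (smt (verit) powr_ge_zero)
  then have G1: "\<mu> * G \<le> 1" using q1 by (smt (verit) gr_one_powr)
  have w0: "0 \<le> w" "w \<le> 1" using UV U1 unfolding w_def by auto
  have \<mu>A: "\<mu> * A \<le> 1 / 50" "0 \<le> \<mu> * A" using small \<mu> A unfolding \<mu>_def by auto
  have "w * (\<mu> * A) \<le> \<mu> * A" using mult_right_mono[OF w0(2) \<mu>A(2)] by simp
  moreover have "\<mu> * \<bar>G - P\<bar> \<le> \<mu> * (w * A)" using GP \<mu> unfolding w_def by (intro mult_left_mono) auto
  ultimately have GPm: "\<mu> * \<bar>G - P\<bar> \<le> w * (\<mu> * A)" "w * (\<mu> * A) \<le> 1/50"
    using \<mu>A by (auto simp: algebra_simps)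
  define \<pi> where "\<pi> = \<mu> * P"
  have \<pi>0: "\<pi> > 0" using \<mu> P unfolding \<pi>_def by simp
  have "\<mu> * P \<le> \<mu> * G + \<mu> * \<bar>G - P\<bar>" using \<mu> by (smt (verit) mult_left_mono distrib_left)
  \<comment> \<open>The excess 1/50 over 1 is the gradient error allowed by
    \<open>small\<close>.\<close>
  then have \<pi>1: "\<pi> \<le> 51 / 50" using GPm G1 unfolding \<pi>_def by linarith
  have N\<mu>: "N / \<mu>\<^sup>2 \<le> 1 / (6 * (p + 1))"
    using \<mu>2 \<mu> p by (simp add: field_simps)
  have P2: "P\<^sup>2 = \<pi>\<^sup>2 / \<mu>\<^sup>2" using \<mu> unfolding \<pi>_def by (simp add: power_mult_distrib)
  have w\<kappa>: "w * \<kappa> = 2 * (N / \<mu>\<^sup>2) * \<pi>\<^sup>2"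
    using w r \<mu> unfolding w_def \<kappa>_def \<pi>_def by (simp add: power2_eq_square field_simps)
  \<comment> \<open>The hypothesis \<open>y\<close> bounds \<open>r\<close> from above. Substituted
    into \<open>w = 2 * P * r\<close>, this leaves the positive power \<open>2 - q\<close> of
    \<open>\<pi>\<close>, to which the upper bound on \<open>\<pi>\<close> applies.\<close>
  have "\<pi> powr q * r \<le> N * P" using y MG[of P] P r unfolding \<pi>_def by (simp add: field_simps)
  then have "r \<le> N * P / \<pi> powr q" using \<pi>0 by (simp add: field_simps)
  then have "w \<le> 2 * P * (N * P / \<pi> powr q)" 
    unfolding w_def w using P mult_left_mono[of r "N * P / \<pi> powr q" "2 * P"] by simp
  also have "\<dots> = 2 * (N / \<mu>\<^sup>2) * (\<pi>\<^sup>2 / \<pi> powr q)"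
  proof -
    have "2 * P * (N * P / \<pi> powr q) = 2 * N * P\<^sup>2 / \<pi> powr q" by (simp add: power2_eq_square)
    then show ?thesis unfolding P2 by simp
  qed
  also have "\<pi>\<^sup>2 / \<pi> powr q = \<pi> powr (2 - q)" using \<pi>0 by (simp add: powr_diff)
  finally have w1: "w \<le> 2 * (N / \<mu>\<^sup>2) * \<pi> powr (2 - q)" .
  have "\<pi> powr (2 - q) \<le> (51/50) powr (2 - q)" using \<pi>0 \<pi>1 q1 by (intro powr_mono2) auto
  also have "\<dots> \<le> (51/50) powr 1" using q1 by (intro powr_mono) auto
  finally have \<pi>q: "\<pi> powr (2 - q) \<le> 51/50" by simp
  have \<pi>s: "\<pi>\<^sup>2 \<le> (51/50)\<^sup>2" using \<pi>0 \<pi>1 by (intro power_mono) auto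
  \<comment> \<open>The two summands bound \<open>w\<close> and \<open>w * \<kappa>\<close>. As
    \<open>N / \<mu>\<^sup>2\<close> is at most 1/(6(p+1)), the total is at most 0.6868/(p+1); this
    is where the constant 6 enters.\<close>
  have "(1 + \<kappa>) * w \<le> 2 * (N / \<mu>\<^sup>2) * (\<pi> powr (2 - q) + \<pi>\<^sup>2)"
    using w1 w\<kappa> by (simp add: algebra_simps)
  also have "\<dots> \<le> 2 * (1 / (6 * (p + 1))) * (51/50 + (51/50)\<^sup>2)"
    using N\<mu> \<pi>q \<pi>s N p by (intro mult_mono) auto
  also have "\<dots> \<le> (7/10) / (p + 1)" using p by (simp add: field_simps power2_eq_square)
  finally have kw: "(1 + \<kappa>) * w \<le> (7/10) / (p + 1)" .
  then have kwp: "p * ((1 + \<kappa>) * w) \<le> 7/10"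
  proof -
    have "p * ((1 + \<kappa>) * w) \<le> p * ((7/10) / (p + 1))" using kw p by (intro mult_left_mono) auto
    also have "\<dots> \<le> 7/10" using p by (simp add: field_simps)
    finally show ?thesis .
  qed
  have kwh: "(1 + \<kappa>) * w \<le> 7/20"
  proof -
    have "(7/10) / (p + 1) \<le> 7/20" using p by (simp add: field_simps)
    with kw show ?thesis by linarith
  qed
  have S: "U powr p - V powr p \<le> p * w" using powr_diff_le[of V U p] UV U1 p unfolding w_def by auto
  \<comment> \<open>Only an increase from \<open>P\<close> to \<open>G\<close> can contribute; in
    that case \<open>\<mu> * P\<close> and \<open>\<mu> * G\<close> both lie in [0,1] and
    \<open>powr_diff_le\<close> applies.\<close>
  have gr: "M * (G powr q - P powr q) \<le> w / 25"
  proof (cases "P \<le> G")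
    case True
    have "(\<mu> * G) powr q - (\<mu> * P) powr q \<le> q * (\<mu> * G - \<mu> * P)"
      using True \<mu> P G1 q1 by (intro powr_diff_le) auto
    also have "\<dots> = q * (\<mu> * \<bar>G - P\<bar>)" using True by (simp add: algebra_simps)
    also have "\<dots> \<le> 2 * (w * (\<mu> * A))" 
      using mult_mono[of q 2 "\<mu> * \<bar>G - P\<bar>" "w * (\<mu> * A)"] GPm(1) q1 \<mu> by simp
    also have "\<dots> \<le> 2 * (w * (1/50))" using \<mu>A w0 by (intro mult_left_mono) auto
    finally show ?thesis using MG[OF G] MG[of P] P by (simp add: algebra_simps)
  next
    case False
    then have "G powr q \<le> P powr q" using G q1 by (intro powr_mono2) auto
    then have "M * (G powr q - P powr q) \<le> 0" using M by (simp add: mult_le_0_iff)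
    then show ?thesis using w0 by simp
  qed
  have wB: "w * B \<le> w / 20" using small w0 mult_left_mono[of B "1/20" w] by simp
  have "U powr p - V powr p + M * (G powr q - P powr q) + w * B \<le> p * w + w / 25 + w / 20"
    using S gr wB by linarith
  then have "(1 + \<kappa>) * (U powr p - V powr p + M * (G powr q - P powr q) + w * B)
      \<le> (1 + \<kappa>) * (p * w + w / 25 + w / 20)" using \<kappa> by (intro mult_left_mono) auto
  also have "\<dots> = p * ((1 + \<kappa>) * w) + (9/100) * ((1 + \<kappa>) * w)" by (simp add: algebra_simps)
  also have "\<dots> \<le> 7/10 + (9/100) * (7/20)" using kwp kwh by linarith
  finally have b1: "(1 + \<kappa>) * (U powr p - V powr p + M * (G powr q - P powr q) + w * B) \<le> 7/10 + (9/100) * (7/20)" .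
  \<comment> \<open>With \<open>\<mu>\<^sup>2\<close> at least 1, the product \<open>P * A\<close>
    is dominated by \<open>\<pi> * (\<mu> * A)\<close>, whose factors are already bounded.\<close>
  have "N * (p + 1) \<ge> 1 * 2" using N p by (intro mult_mono) auto
  then have "\<mu>\<^sup>2 \<ge> 1" using \<mu>2 by linarith
  then have "\<mu>\<^sup>2 * (P * A) \<ge> P * A" using P A mult_right_mono[of 1 "\<mu>\<^sup>2" "P * A"] by auto
  moreover have "\<mu>\<^sup>2 * (P * A) = \<pi> * (\<mu> * A)" unfolding \<pi>_def by (simp add: power2_eq_square)
  moreover have "\<pi> * (\<mu> * A) \<le> (51/50) * (1/50)" using \<pi>1 \<mu>A \<pi>0 by (intro mult_mono) auto
  ultimately have "P * A \<le> (51/50) * (1/50)" by linarith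
  then show False using main b1 unfolding w_def \<kappa>_def by linarith
qed

text \<open>
  The equation is invariant under parabolic scaling with \<open>u\<close> of degree \<open>-2/(p-1)\<close>; the
  reciprocal length \<open>h\<close> reduces the general case to \<open>E = 1\<close>.
\<close>

lemma touching_inequality_fails:
  fixes p q M N U V G P r A B E h :: real
  assumes p: "p > 1" and q: "q = 2 * p / (p + 1)" and N: "N \<ge> 1" and M: "M > 0"
    and Mbig: "(M powr (1 / q))\<^sup>2 \<ge> 6 * N * (p + 1)"
    and UV: "0 \<le> V" "V \<le> U" and G: "0 \<le> G" and P: "0 < P" and r: "0 < r"
    and A: "0 \<le> A" and B: "0 \<le> B"
    and E: "E = U powr p + M * G powr q" and E0: "E > 0" and h: "h = E powr ((p - 1) / (2 * p))"
    and w: "U - V = 2 * P * r" and GP: "\<bar>G - P\<bar> \<le> (U - V) * A"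
    and y: "M * P powr q \<le> N * P / r"
    and main: "E\<^sup>2 \<le> (E + N * P / r) * (U powr p - V powr p + M * (G powr q - P powr q) + (U - V) * B)
                 + 2 * E * P * A"
    and small: "50 * (M powr (1 / q)) * A \<le> h" "20 * B \<le> h\<^sup>2"
  shows False
proof -
  \<comment> \<open>\<open>a\<close> is the unit of \<open>u\<close> and \<open>a * h\<close> that
    of its gradient. The identities \<open>ap\<close>, \<open>ah2\<close> and \<open>ahq\<close> say
    that the power term, the Laplacian and the gradient term all have unit \<open>E\<close>; the
    last one rests on \<open>q = 2 * p / (p + 1)\<close>.\<close>
  define a where "a = h powr (2 / (p - 1))"
  have h0: "h > 0" and a0: "a > 0" using E0 unfolding a_def h by auto
  have "(p - 1) / (2 * p) * (2 / (p - 1)) = 1 / p" using p by (simp add: field_simps)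
  then have aE: "a = E powr (1 / p)" unfolding a_def h powr_powr by simp
  have ap: "a powr p = E" using p E0 unfolding aE by (simp add: powr_powr)
  have ah2: "a * h\<^sup>2 = E"
  proof -
    have "a * h\<^sup>2 = E powr (1 / p) * (E powr ((p - 1) / (2 * p)) * E powr ((p - 1) / (2 * p)))"
      unfolding aE h power2_eq_square ..
    also have "\<dots> = E powr (1 / p + ((p - 1) / (2 * p) + (p - 1) / (2 * p)))" by (simp only: powr_add)
    also have "1 / p + ((p - 1) / (2 * p) + (p - 1) / (2 * p)) = 1" using p by (simp add: field_simps)
    finally show ?thesis using E0 by simp
  qed
  have ahq: "(a * h) powr q = E"
  proof -
    have "a * h = E powr (1 / p + (p - 1) / (2 * p))" unfolding aE h by (simp add: powr_add)
    then have "(a * h) powr q = E powr ((1 / p + (p - 1) / (2 * p)) * q)" by (simp add: powr_powr)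
    also have "(1 / p + (p - 1) / (2 * p)) * q = 1" using p unfolding q by (simp add: divide_simps)
    finally show ?thesis using E0 by simp
  qed
  have k: "N * (P / (a * h)) / (r * h) = (N * P / r) / E"
    unfolding ah2[symmetric] using a0 h0 r by (simp add: field_simps power2_eq_square)
  have Gs: "(g / (a * h)) powr q = g powr q / E" if "g \<ge> 0" for g
    using that a0 h0 by (simp add: powr_divide ahq)
  have Us: "(g / a) powr p = g powr p / E" if "g \<ge> 0" for g
    using that a0 by (simp add: powr_divide ap)
  show False
  proof (rule touching_inequality_fails_normalized[OF p q N M Mbig,
        where U = "U / a" and V = "V / a" and G = "G / (a * h)" and P = "P / (a * h)"
          and r = "r * h" and A = "A / h" and B = "B / h\<^sup>2"])
    show "(U / a) powr p + M * (G / (a * h)) powr q = 1"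
      using UV G E E0 by (simp add: Us Gs add_divide_distrib[symmetric])
    show "U / a - V / a = 2 * (P / (a * h)) * (r * h)"
      using w a0 h0 by (simp add: field_simps)
    show "\<bar>G / (a * h) - P / (a * h)\<bar> \<le> (U / a - V / a) * (A / h)"
      using GP a0 h0 by (simp add: diff_divide_distrib[symmetric] divide_right_mono)
    show "M * (P / (a * h)) powr q \<le> N * (P / (a * h)) / (r * h)"
      unfolding k using divide_right_mono[OF y, of E] P E0 by (simp add: Gs)
    have wB: "(U / a - V / a) * (B / h\<^sup>2) = ((U - V) * B) / E"
      unfolding ah2[symmetric] by (simp add: diff_divide_distrib[symmetric])
    have PA: "2 * (P / (a * h)) * (A / h) = 2 * (P * A / E)"
      unfolding ah2[symmetric] by (simp add: power2_eq_square)
    have "E\<^sup>2 / E\<^sup>2 \<le> ((E + N * P / r) * (U powr p - V powr p + M * (G powr q - P powr q) + (U - V) * B)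
                 + 2 * E * P * A) / E\<^sup>2" using main by (intro divide_right_mono) auto
    also have "\<dots> = (1 + (N * P / r) / E) * (U powr p / E - V powr p / E + M * (G powr q / E - P powr q / E) + (U - V) * B / E)
                 + 2 * (P * A / E)" using E0 r by (simp add: power2_eq_square field_simps)
    finally show "1 \<le> (1 + N * (P / (a * h)) / (r * h)) *
         ((U / a) powr p - (V / a) powr p + M * ((G / (a * h)) powr q - (P / (a * h)) powr q) +
          (U / a - V / a) * (B / h\<^sup>2)) + 2 * (P / (a * h)) * (A / h)"
      unfolding k wB PA using UV G P E0 by (simp add: Gs Us)
    show "50 * M powr (1 / q) * (A / h) \<le> 1" using small h0 by (simp add: field_simps)
    show "20 * (B / h\<^sup>2) \<le> 1" using small h0 by (simp add: field_simps)
  qed (use UV G P r A B a0 h0 in \<open>auto simp: divide_right_mono\<close>)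
qed

section \<open>Derivative tests at a maximum of the Hoelder quotient\<close>

text \<open>If \<open>l\<close> were positive, \<open>f'\<close> would be positive just to the right
  of 0 and, by the mean value theorem, \<open>f\<close> would exceed \<open>f 0\<close> there.
  Differentiability of \<open>f'\<close> at the single point 0 suffices.\<close>

lemma second_derivative_nonpos_at_local_max:
  fixes f f' :: "real \<Rightarrow> real"
  assumes d: "0 < d"
    and f: "\<And>s. \<bar>s\<bar> < d \<Longrightarrow> (f has_real_derivative f' s) (at s)"
    and f': "(f' has_real_derivative l) (at 0)"
    and max: "\<And>s. \<bar>s\<bar> < d \<Longrightarrow> f s \<le> f 0"
  shows "f' 0 = 0" and "l \<le> 0"
proof -
  show z: "f' 0 = 0" using DERIV_local_max[OF f[of 0] d] d max by auto
  show "l \<le> 0"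
  proof (rule ccontr)
    assume "\<not> l \<le> 0"
    then obtain e where e: "e > 0" "\<And>h. 0 < h \<Longrightarrow> h < e \<Longrightarrow> f' 0 < f' h"
      using DERIV_pos_inc_right[OF f'] by auto
    define b where "b = min d e / 2"
    have b: "0 < b" "b < d" "b < e" using d e unfolding b_def by auto
    obtain c where c: "0 < c" "c < b" "f b - f 0 = (b - 0) * f' c"
      using MVT2[OF b(1), of f f'] f b by auto
    have "f' c > 0" using e(2)[of c] c b z by auto
    then have "f b > f 0" using c b by (simp add: field_simps)
    with max[of b] b show False by auto
  qed
qed

text \<open>The maximum is sought among times \<open>t \<le> t0\<close> and may lie at
  \<open>t = t0\<close>, so only earlier times can be compared and only one sign of the derivative
  follows.\<close>

lemma left_local_max_deriv_nonneg:
  fixes f :: "real \<Rightarrow> real"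
  assumes "0 < d" "(f has_real_derivative l) (at t)"
    and "\<And>s. 0 < s \<Longrightarrow> s < d \<Longrightarrow> f (t - s) \<le> f t"
  shows "0 \<le> l"
proof (rule ccontr)
  assume "\<not> 0 \<le> l"
  then obtain e where e: "e > 0" "\<And>h. 0 < h \<Longrightarrow> h < e \<Longrightarrow> f t < f (t - h)"
    using DERIV_neg_dec_left[OF assms(2)] by auto
  define b where "b = min d e / 2"
  have "0 < b" "b < d" "b < e" using assms(1) e(1) unfolding b_def by auto
  then show False using e(2)[of b] assms(3)[of b] by simp
qed

lemma partial_line:
  assumes "\<And>z. partially_differentiable i f z"
  shows "((\<lambda>s. f (x + (a * s) *\<^sub>R i)) has_real_derivative a * partial i f (x + (a * s) *\<^sub>R i)) (at s)"
proof -
  have "(\<lambda>k. f ((x + (a * s) *\<^sub>R i) + k *\<^sub>R i)) differentiable (at 0)"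
    using assms unfolding partially_differentiable_def by blast
  then have "((\<lambda>k. f ((x + (a * s) *\<^sub>R i) + k *\<^sub>R i)) has_real_derivative partial i f (x + (a * s) *\<^sub>R i)) (at 0)"
    unfolding partial_def by (metis DERIV_deriv_iff_real_differentiable)
  then have "((\<lambda>k. f (x + k *\<^sub>R i)) has_real_derivative partial i f (x + (a * s) *\<^sub>R i)) (at (0 + a * s))"
    by (subst DERIV_shift) (simp add: scaleR_add_left add.assoc add.commute add.left_commute)
  then have "((\<lambda>k. f (x + k *\<^sub>R i)) has_real_derivative partial i f (x + (a * s) *\<^sub>R i)) (at (a * s))"
    by simp
  then have "((\<lambda>s. f (x + (a * s) *\<^sub>R i)) has_real_derivative partial i f (x + (a * s) *\<^sub>R i) * a) (at s)"
    by (rule DERIV_chain2[where f = "\<lambda>k. f (x + k *\<^sub>R i)" and g = "\<lambda>s. a * s"])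
      (auto intro!: derivative_eq_intros)
  then show ?thesis by (simp add: mult.commute)
qed

text \<open>The difference of the two sides of \<open>le\<close> has a local maximum at
  \<open>s = 0\<close>, so its derivative vanishes and its second derivative is nonpositive there.
  The two polynomials are meant to be the squared distance and the cutoff along a line. Writing
  their powers as an exponential of logarithms gives the bound \<open>Z\<close> the derivative
  \<open>Z s * l s\<close> with \<open>l\<close> rational.\<close>

lemma touching_on_line:
  fixes f :: "'a::euclidean_space \<Rightarrow> real"
  assumes i: "i \<in> Basis"
    and f1: "\<And>z. partially_differentiable i f z"
    and f2: "\<And>z. partially_differentiable i (partial i f) z"
    and pos: "0 < A0" "0 < B0" and d: "0 < d"
    and le: "\<And>s. \<bar>s\<bar> < d \<Longrightarrow> 0 < A0 + A1 * s + A2 * s\<^sup>2 \<Longrightarrow> 0 < B0 + B1 * s + B2 * s\<^sup>2 \<Longrightarrow>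
      f (x + (a * s) *\<^sub>R i) - f (y + (b * s) *\<^sub>R i)
       \<le> w * exp (\<alpha> * (ln (A0 + A1 * s + A2 * s\<^sup>2) - ln A0) - m * (ln (B0 + B1 * s + B2 * s\<^sup>2) - ln B0))"
    and eq: "f x - f y = w"
  shows "a * partial i f x - b * partial i f y = w * (\<alpha> * A1 / A0 - m * B1 / B0)"
    and "a\<^sup>2 * partial i (partial i f) x - b\<^sup>2 * partial i (partial i f) y
      \<le> w * (\<alpha> * (2 * A2 / A0 - A1\<^sup>2 / A0\<^sup>2) - m * (2 * B2 / B0 - B1\<^sup>2 / B0\<^sup>2)
             + (\<alpha> * A1 / A0 - m * B1 / B0)\<^sup>2)"
proof -
  define A where "A = (\<lambda>s::real. A0 + A1 * s + A2 * s\<^sup>2)"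
  define B where "B = (\<lambda>s::real. B0 + B1 * s + B2 * s\<^sup>2)"
  define Z where "Z = (\<lambda>s. w * exp (\<alpha> * (ln (A s) - ln A0) - m * (ln (B s) - ln B0)))"
  define l where "l = (\<lambda>s. \<alpha> * ((A1 + 2 * A2 * s) / A s) - m * ((B1 + 2 * B2 * s) / B s))"
  \<comment> \<open>Continuity keeps both polynomials positive near 0, so there \<open>le\<close>
    applies and the logarithms are differentiable.\<close>
  have "\<forall>\<^sub>F s in at 0. 0 < A s \<and> 0 < B s"
  proof (intro eventually_conj)
    have "(A \<longlongrightarrow> A 0) (at 0)" "(B \<longlongrightarrow> B 0) (at 0)" unfolding A_def B_def by (auto intro!: tendsto_eq_intros)
    then show "\<forall>\<^sub>F s in at 0. 0 < A s" "\<forall>\<^sub>F s in at 0. 0 < B s"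
      using pos by (auto intro: order_tendstoD simp: A_def B_def)
  qed
  then obtain e where e: "e > 0" "\<And>s. s \<noteq> 0 \<Longrightarrow> \<bar>s\<bar> < e \<Longrightarrow> 0 < A s \<and> 0 < B s"
    unfolding eventually_at by auto
  define k where "k = min d e"
  have k: "k > 0" using d e unfolding k_def by auto
  have AB: "0 < A s" "0 < B s" if "\<bar>s\<bar> < k" for s
    using that e(2)[of s] pos unfolding k_def by (cases "s = 0"; auto simp: A_def B_def)+
  have dA: "(A has_real_derivative (A1 + 2 * A2 * s)) (at s)"
    and dB: "(B has_real_derivative (B1 + 2 * B2 * s)) (at s)" for s
    unfolding A_def B_def by (auto intro!: derivative_eq_intros)
  have dZ: "(Z has_real_derivative Z s * l s) (at s)" if "\<bar>s\<bar> < k" for s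
  proof -
    have "((\<lambda>s. ln (A s)) has_real_derivative (A1 + 2 * A2 * s) / A s) (at s)"
      "((\<lambda>s. ln (B s)) has_real_derivative (B1 + 2 * B2 * s) / B s) (at s)"
      using AB[OF that] by (auto intro!: derivative_eq_intros dA dB simp: divide_inverse)
    then have "((\<lambda>s. \<alpha> * (ln (A s) - ln A0) - m * (ln (B s) - ln B0)) has_real_derivative
        \<alpha> * ((A1 + 2 * A2 * s) / A s - 0) - m * ((B1 + 2 * B2 * s) / B s - 0)) (at s)"
      by (intro DERIV_diff DERIV_cmult DERIV_const)
    then have "((\<lambda>s. \<alpha> * (ln (A s) - ln A0) - m * (ln (B s) - ln B0)) has_real_derivative l s) (at s)"
      unfolding l_def by simp
    from DERIV_cmult[OF DERIV_fun_exp[OF this], of w]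
    show ?thesis unfolding Z_def by (simp add: mult.assoc)
  qed
  have Z0: "Z 0 = w" unfolding Z_def A_def B_def by simp
  have l0: "l 0 = \<alpha> * A1 / A0 - m * B1 / B0" unfolding l_def A_def B_def by simp
  have dl: "(l has_real_derivative
      \<alpha> * (2 * A2 / A0 - A1\<^sup>2 / A0\<^sup>2) - m * (2 * B2 / B0 - B1\<^sup>2 / B0\<^sup>2)) (at 0)"
  proof -
    have z: "A 0 = A0" "B 0 = B0" unfolding A_def B_def by auto
    have "((\<lambda>s. (A1 + 2 * A2 * s) / A s) has_real_derivative 2 * A2 / A0 - A1\<^sup>2 / A0\<^sup>2) (at 0)"
      using pos z by (auto intro!: derivative_eq_intros dA simp: z diff_divide_distrib power2_eq_square)
    moreover have "((\<lambda>s. (B1 + 2 * B2 * s) / B s) has_real_derivative 2 * B2 / B0 - B1\<^sup>2 / B0\<^sup>2) (at 0)"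
      using pos z by (auto intro!: derivative_eq_intros dB simp: z diff_divide_distrib power2_eq_square)
    ultimately show ?thesis unfolding l_def by (intro DERIV_diff DERIV_cmult)
  qed
  define h where "h = (\<lambda>s. f (x + (a * s) *\<^sub>R i) - f (y + (b * s) *\<^sub>R i) - Z s)"
  define h' where "h' = (\<lambda>s. a * partial i f (x + (a * s) *\<^sub>R i) - b * partial i f (y + (b * s) *\<^sub>R i) - Z s * l s)"
  have 1: "(h has_real_derivative h' s) (at s)" if "\<bar>s\<bar> < k" for s
    unfolding h_def h'_def by (intro DERIV_diff partial_line f1 dZ that)
  have 2: "(h' has_real_derivative a * (a * partial i (partial i f) x) - b * (b * partial i (partial i f) y)
      - (w * l 0 * l 0 + w * (\<alpha> * (2 * A2 / A0 - A1\<^sup>2 / A0\<^sup>2) - m * (2 * B2 / B0 - B1\<^sup>2 / B0\<^sup>2)))) (at 0)"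
  proof -
    have "((\<lambda>s. Z s * l s) has_real_derivative
      (w * l 0 * l 0 + w * (\<alpha> * (2 * A2 / A0 - A1\<^sup>2 / A0\<^sup>2) - m * (2 * B2 / B0 - B1\<^sup>2 / B0\<^sup>2)))) (at 0)"
      using DERIV_mult[OF dZ dl] k by (simp add: Z0 algebra_simps)
    moreover have "((\<lambda>s. a * partial i f (x + (a * s) *\<^sub>R i)) has_real_derivative
        a * (a * partial i (partial i f) x)) (at 0)"
      and "((\<lambda>s. b * partial i f (y + (b * s) *\<^sub>R i)) has_real_derivative
        b * (b * partial i (partial i f) y)) (at 0)"
      using partial_line[OF f2, of x a 0] partial_line[OF f2, of y b 0] by (auto intro: DERIV_cmult)
    ultimately show ?thesis unfolding h'_def by (intro DERIV_diff)
  qed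
  have 3: "h s \<le> h 0" if "\<bar>s\<bar> < k" for s
    using le[of s] AB[OF that] that eq Z0 unfolding h_def k_def Z_def A_def B_def by auto
  from second_derivative_nonpos_at_local_max[OF k 1 2 3]
  have "h' 0 = 0" "a * (a * partial i (partial i f) x) - b * (b * partial i (partial i f) y)
      - (w * l 0 * l 0 + w * (\<alpha> * (2 * A2 / A0 - A1\<^sup>2 / A0\<^sup>2) - m * (2 * B2 / B0 - B1\<^sup>2 / B0\<^sup>2))) \<le> 0"
    by auto
  then show "a * partial i f x - b * partial i f y = w * (\<alpha> * A1 / A0 - m * B1 / B0)"
    and "a\<^sup>2 * partial i (partial i f) x - b\<^sup>2 * partial i (partial i f) y
      \<le> w * (\<alpha> * (2 * A2 / A0 - A1\<^sup>2 / A0\<^sup>2) - m * (2 * B2 / B0 - B1\<^sup>2 / B0\<^sup>2)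
             + (\<alpha> * A1 / A0 - m * B1 / B0)\<^sup>2)"
    unfolding h'_def l0[symmetric] by (auto simp: Z0 power2_eq_square algebra_simps)
qed

text \<open>Equal to 1 at \<open>(x0, t0)\<close>; among times \<open>t \<le> t0\<close> it is
  positive only on a bounded region. Time enters linearly, in accordance with parabolic
  scaling.\<close>

definition cutoff :: "real \<Rightarrow> 'a::euclidean_space \<Rightarrow> real \<Rightarrow> 'a \<Rightarrow> real \<Rightarrow> real" where
  "cutoff R x0 t0 x t = 1 - ((norm (x - x0))\<^sup>2 + (t0 - t)) / R\<^sup>2"

text \<open>The cutoff is evaluated at \<open>x\<close> only, so the first-order condition at
  \<open>y\<close> is free of cutoff terms. At a maximum \<open>y\<close> still cannot be far away:
  nonnegativity of \<open>u\<close> bounds the numerator while the distance in the denominator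
  grows.\<close>

definition holder_quotient ::
    "real \<Rightarrow> real \<Rightarrow> 'a::euclidean_space \<Rightarrow> real \<Rightarrow> ('a \<Rightarrow> real \<Rightarrow> real) \<Rightarrow> 'a \<Rightarrow> 'a \<Rightarrow> real \<Rightarrow> real" where
  "holder_quotient m R x0 t0 u x y t =
     cutoff R x0 t0 x t powr m * (u x t - u y t) / sqrt (norm (x - y))"

definition maximal_triple ::
    "real \<Rightarrow> real \<Rightarrow> 'a::euclidean_space \<Rightarrow> real \<Rightarrow> ('a \<Rightarrow> real \<Rightarrow> real) \<Rightarrow> 'a \<Rightarrow> 'a \<Rightarrow> real \<Rightarrow> bool" where
  "maximal_triple m R x0 t0 u x y t \<longleftrightarrow>
     t \<le> t0 \<and> x \<noteq> y \<and> 0 < cutoff R x0 t0 x t \<and> u y t < u x t \<and>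
     (\<forall>x' y' t'. t' \<le> t0 \<longrightarrow> x' \<noteq> y' \<longrightarrow> 0 < cutoff R x0 t0 x' t' \<longrightarrow>
        holder_quotient m R x0 t0 u x' y' t' \<le> holder_quotient m R x0 t0 u x y t)"

text \<open>The maximality inequality is solved for the difference at the competing triple, with the
  ratio of the weights written as the exponential that \<open>touching_on_line\<close> expects. The
  factor 1/4 is the Hoelder exponent 1/2 referred to the squared distance.\<close>

lemma maximal_triple_le:
  fixes u :: "'a::euclidean_space \<Rightarrow> real \<Rightarrow> real"
  assumes max: "maximal_triple m R x0 t0 u x y t"
    and "t' \<le> t0" "0 < (norm (x' - y'))\<^sup>2" "0 < cutoff R x0 t0 x' t'"
  shows "u x' t' - u y' t' \<le> (u x t - u y t) *
    exp (1/4 * (ln ((norm (x' - y'))\<^sup>2) - ln ((norm (x - y))\<^sup>2))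
         - m * (ln (cutoff R x0 t0 x' t') - ln (cutoff R x0 t0 x t)))"
proof -
  define r r' e e' where "r = norm (x - y)" and "r' = norm (x' - y')"
    and "e = cutoff R x0 t0 x t" and "e' = cutoff R x0 t0 x' t'"
  have pos: "r > 0" "r' > 0" "e > 0" "e' > 0"
    using assms unfolding maximal_triple_def r_def r'_def e_def e'_def by auto
  have "1/4 * (ln (r'\<^sup>2) - ln (r\<^sup>2)) - m * (ln e' - ln e)
      = ln (sqrt r') - ln (sqrt r) - (ln (e' powr m) - ln (e powr m))"
    using pos by (simp add: ln_powr ln_sqrt ln_realpow algebra_simps)
  also have "exp \<dots> = (sqrt r' / sqrt r) / (e' powr m / e powr m)"
    using pos by (simp add: exp_diff powr_def)
  finally have ex: "exp (1/4 * (ln (r'\<^sup>2) - ln (r\<^sup>2)) - m * (ln e' - ln e))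
      = (sqrt r' / sqrt r) / (e' powr m / e powr m)" .
  have "e' powr m * (u x' t' - u y' t') / sqrt r' \<le> e powr m * (u x t - u y t) / sqrt r"
    using assms unfolding maximal_triple_def holder_quotient_def r_def r'_def e_def e'_def by auto
  then have "(e' powr m * (u x' t' - u y' t') / sqrt r') * (sqrt r' / e' powr m)
      \<le> (e powr m * (u x t - u y t) / sqrt r) * (sqrt r' / e' powr m)"
    using pos by (intro mult_right_mono) auto
  moreover have "(e' powr m * (u x' t' - u y' t') / sqrt r') * (sqrt r' / e' powr m) = u x' t' - u y' t'"
    using pos by simp
  ultimately have "u x' t' - u y' t' \<le> (u x t - u y t) * ((sqrt r' / sqrt r) / (e' powr m / e powr m))"
    by (simp add: mult.commute mult.left_commute)
  with ex show ?thesis by (simp only: r_def r'_def e_def e'_def)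
qed

lemma norm_add_Basis_sq:
  fixes v :: "'a::euclidean_space"
  assumes "i \<in> Basis"
  shows "(norm (v + k *\<^sub>R i))\<^sup>2 = (norm v)\<^sup>2 + 2 * k * (v \<bullet> i) + k\<^sup>2"
  using assms by (simp only: power2_norm_eq_inner)
    (simp add: inner_add_left inner_add_right inner_commute power2_eq_square algebra_simps)

text \<open>When \<open>x\<close> moves by \<open>a * s\<close> and \<open>y\<close> by
  \<open>b * s\<close> in direction \<open>i\<close>, the squared distance and the cutoff are
  quadratic in \<open>s\<close>, so \<open>touching_on_line\<close> applies with
  \<open>\<alpha> = 1/4\<close>. The speeds (1,0) and (0,1) will give the gradients, the speeds (1 +
  c, 1) the Laplacians.\<close>

lemma maximal_triple_direction:
  fixes u :: "'a::euclidean_space \<Rightarrow> real \<Rightarrow> real"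
  assumes C: "C21 u" and R: "R > 0" and t0: "t0 < 0"
    and max: "maximal_triple m R x0 t0 u x y t" and i: "i \<in> Basis"
  defines "r \<equiv> norm (x - y)" and "e \<equiv> cutoff R x0 t0 x t" and "w \<equiv> u x t - u y t"
    and "\<rho> \<equiv> (x - y) \<bullet> i" and "z \<equiv> (x - x0) \<bullet> i"
    and "f \<equiv> \<lambda>x. u x t"
  shows "a * partial i f x - b * partial i f y
      = w * ((a - b) * \<rho> / (2 * r\<^sup>2) + 2 * m * a * z / (R\<^sup>2 * e))"
    and "a\<^sup>2 * partial i (partial i f) x - b\<^sup>2 * partial i (partial i f) y
      \<le> w * ((a - b)\<^sup>2 / (2 * r\<^sup>2) - (a - b)\<^sup>2 * \<rho>\<^sup>2 / r^4
           + a\<^sup>2 * (2 * m / (R\<^sup>2 * e) + 4 * m * z\<^sup>2 / (R^4 * e\<^sup>2))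
           + ((a - b) * \<rho> / (2 * r\<^sup>2) + 2 * m * a * z / (R\<^sup>2 * e))\<^sup>2)"
proof -
  have t: "t < 0" and e0: "e > 0" and r0: "r > 0"
    using max t0 unfolding maximal_triple_def e_def r_def by auto
  have f1: "partially_differentiable i f v" for v
    using C t i unfolding C21_def f_def by blast
  have f2: "partially_differentiable i (partial i f) v" for v
    using C t i unfolding C21_def f_def by blast
  have nA: "(norm ((x + (a * s) *\<^sub>R i) - (y + (b * s) *\<^sub>R i)))\<^sup>2
      = r\<^sup>2 + (2 * (a - b) * \<rho>) * s + (a - b)\<^sup>2 * s\<^sup>2" for s
  proof -
    have "(x + (a * s) *\<^sub>R i) - (y + (b * s) *\<^sub>R i) = (x - y) + ((a - b) * s) *\<^sub>R i"
      by (simp add: algebra_simps)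
    then show ?thesis
      unfolding r_def \<rho>_def by (simp only: norm_add_Basis_sq[OF i])
        (simp add: power_mult_distrib mult.commute mult.left_commute)
  qed
  have nB: "cutoff R x0 t0 (x + (a * s) *\<^sub>R i) t = e + (- 2 * a * z / R\<^sup>2) * s + (- a\<^sup>2 / R\<^sup>2) * s\<^sup>2" for s
  proof -
    have 1: "x + (a * s) *\<^sub>R i - x0 = (x - x0) + (a * s) *\<^sub>R i" by simp
    show ?thesis
      unfolding cutoff_def 1 norm_add_Basis_sq[OF i, of "x - x0" "a * s"] e_def cutoff_def z_def
      by (simp add: power_mult_distrib add_divide_distrib)
  qed
  have le: "f (x + (a * s) *\<^sub>R i) - f (y + (b * s) *\<^sub>R i)
       \<le> w * exp (1/4 * (ln (r\<^sup>2 + (2 * (a - b) * \<rho>) * s + (a - b)\<^sup>2 * s\<^sup>2) - ln (r\<^sup>2))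
           - m * (ln (e + (- 2 * a * z / R\<^sup>2) * s + (- a\<^sup>2 / R\<^sup>2) * s\<^sup>2) - ln e))"
    if "\<bar>s\<bar> < 1" "0 < r\<^sup>2 + (2 * (a - b) * \<rho>) * s + (a - b)\<^sup>2 * s\<^sup>2"
      "0 < e + (- 2 * a * z / R\<^sup>2) * s + (- a\<^sup>2 / R\<^sup>2) * s\<^sup>2" for s
    using maximal_triple_le[OF max, of t "x + (a * s) *\<^sub>R i" "y + (b * s) *\<^sub>R i"] max that
    unfolding nA nB by (simp add: maximal_triple_def f_def w_def e_def r_def)
  have pos: "0 < r\<^sup>2" using r0 by simp
  have eq: "f x - f y = w" unfolding f_def w_def ..
  have s: "1/4 * (2 * (a - b)\<^sup>2 / r\<^sup>2 - (2 * (a - b) * \<rho>)\<^sup>2 / (r\<^sup>2)\<^sup>2)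
      = (a - b)\<^sup>2 / (2 * r\<^sup>2) - (a - b)\<^sup>2 * \<rho>\<^sup>2 / r^4"
    "1/4 * (2 * (a - b) * \<rho>) / r\<^sup>2 - m * (- 2 * a * z / R\<^sup>2) / e = (a - b) * \<rho> / (2 * r\<^sup>2) + 2 * m * a * z / (R\<^sup>2 * e)"
    "- m * (2 * (- a\<^sup>2 / R\<^sup>2) / e - (- 2 * a * z / R\<^sup>2)\<^sup>2 / e\<^sup>2) = a\<^sup>2 * (2 * m / (R\<^sup>2 * e) + 4 * m * z\<^sup>2 / (R^4 * e\<^sup>2))"
    using R r0 e0 by (simp_all add: power_mult_distrib power_divide field_simps power4_eq_xxxx power2_eq_square)
  show "a * partial i f x - b * partial i f y
      = w * ((a - b) * \<rho> / (2 * r\<^sup>2) + 2 * m * a * z / (R\<^sup>2 * e))"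
    using touching_on_line(1)[OF i f1 f2 pos e0 zero_less_one le eq] unfolding s(2) .
  show "a\<^sup>2 * partial i (partial i f) x - b\<^sup>2 * partial i (partial i f) y
      \<le> w * ((a - b)\<^sup>2 / (2 * r\<^sup>2) - (a - b)\<^sup>2 * \<rho>\<^sup>2 / r^4
           + a\<^sup>2 * (2 * m / (R\<^sup>2 * e) + 4 * m * z\<^sup>2 / (R^4 * e\<^sup>2))
           + ((a - b) * \<rho> / (2 * r\<^sup>2) + 2 * m * a * z / (R\<^sup>2 * e))\<^sup>2)"
    using touching_on_line(2)[OF i f1 f2 pos e0 zero_less_one le eq] unfolding s(3)[symmetric] s(1)[symmetric] s(2)[symmetric]
    by simp
qed

text \<open>The difference minus its exponential bound cannot be larger at slightly earlier times.
  The cutoff grows in time at rate \<open>1 / R\<^sup>2\<close>, and its logarithmic derivative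
  produces the left-hand side.\<close>

lemma maximal_triple_time:
  fixes u :: "'a::euclidean_space \<Rightarrow> real \<Rightarrow> real"
  assumes C: "C21 u" and R: "R > 0" and t0: "t0 < 0"
    and max: "maximal_triple m R x0 t0 u x y t"
  defines "e \<equiv> cutoff R x0 t0 x t" and "w \<equiv> u x t - u y t"
  shows "- w * m / (R\<^sup>2 * e) \<le> time_deriv u x t - time_deriv u y t"
proof -
  have t: "t < 0" "t \<le> t0" and e0: "e > 0" and xy: "x \<noteq> y"
    using max t0 unfolding maximal_triple_def e_def by auto
  define c where "c = (\<lambda>s. cutoff R x0 t0 x s)"
  have dc: "(c has_real_derivative 1 / R\<^sup>2) (at t)"
    unfolding c_def cutoff_def using R by (auto intro!: derivative_eq_intros simp: power4_eq_xxxx power2_eq_square)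
  have ct: "c t = e" unfolding c_def e_def ..
  have "((\<lambda>s. ln (c s)) has_real_derivative (1 / R\<^sup>2) / e) (at t)"
    using e0 ct by (auto intro!: derivative_eq_intros dc)
  then have "((\<lambda>s. - m * (ln (c s) - ln e)) has_real_derivative - m * ((1 / R\<^sup>2) / e - 0)) (at t)"
    by (intro DERIV_diff DERIV_cmult DERIV_const)
  from DERIV_cmult[OF DERIV_fun_exp[OF this], of w]
  have dZ: "((\<lambda>s. w * exp (- m * (ln (c s) - ln e))) has_real_derivative - w * m / (R\<^sup>2 * e)) (at t)"
    by (simp add: ct)
  have du: "((\<lambda>s. u v s) has_real_derivative time_deriv u v t) (at t)" for v
    using C t unfolding C21_def time_deriv_def by (simp add: DERIV_deriv_iff_real_differentiable)
  have "(c \<longlongrightarrow> c t) (at t)" using DERIV_isCont[OF dc] unfolding isCont_def .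
  then have "\<forall>\<^sub>F s in at t. 0 < c s" using e0 ct by (intro order_tendstoD) auto
  then obtain d where d: "d > 0" "\<And>s. s \<noteq> t \<Longrightarrow> dist s t < d \<Longrightarrow> 0 < c s"
    unfolding eventually_at by auto
  have "0 \<le> time_deriv u x t - time_deriv u y t - (- w * m / (R\<^sup>2 * e))"
  proof (rule left_local_max_deriv_nonneg[OF d(1) DERIV_diff[OF DERIV_diff[OF du du] dZ]])
    fix s assume s: "0 < s" "s < d"
    have "0 < c (t - s)" using d(2)[of "t - s"] s by (simp add: dist_real_def)
    then show "u x (t - s) - u y (t - s) - w * exp (- m * (ln (c (t - s)) - ln e))
        \<le> u x t - u y t - w * exp (- m * (ln (c t) - ln e))"
      using maximal_triple_le[OF max, of "t - s" x y] xy t s unfolding ct by (simp add: w_def c_def e_def)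
  qed
  then show ?thesis by simp
qed

lemma sum_Basis_power2_inner: "(\<Sum>i\<in>Basis. (v \<bullet> i)\<^sup>2) = (norm (v::'a::euclidean_space))\<^sup>2"
  unfolding power2_norm_eq_inner euclidean_inner[of v v] by (simp add: power2_eq_square)

lemma sum_Basis_quadratic:
  fixes v z :: "'a::euclidean_space"
  shows "(\<Sum>i\<in>Basis. s * (k - l * (v \<bullet> i)\<^sup>2 + b * (z \<bullet> i)\<^sup>2 + d * ((v \<bullet> i) * (z \<bullet> i))))
    = s * (real DIM('a) * k - l * (norm v)\<^sup>2 + b * (norm z)\<^sup>2 + d * (v \<bullet> z))"
  unfolding sum_distrib_left[symmetric] sum.distrib sum_subtractf sum_Basis_power2_inner
    euclidean_inner[symmetric] by simp

text \<open>By the first-order conditions, the gradient at \<open>y\<close> is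
  \<open>w / (2 * r\<^sup>2)\<close> times \<open>x - y\<close>, and the gradient at
  \<open>x\<close> differs from it only by the multiple of \<open>x - x0\<close> that the cutoff
  causes.\<close>

lemma maximal_triple_gradients:
  fixes u :: "'a::euclidean_space \<Rightarrow> real \<Rightarrow> real"
  assumes C: "C21 u" and R: "R > 0" and t0: "t0 < 0" and m: "m \<ge> 0"
    and max: "maximal_triple m R x0 t0 u x y t"
  defines "r \<equiv> norm (x - y)" and "e \<equiv> cutoff R x0 t0 x t" and "w \<equiv> u x t - u y t"
    and "f \<equiv> \<lambda>x. u x t"
  shows "norm (gradient f y) = w / (2 * r)"
    and "\<bar>norm (gradient f x) - w / (2 * r)\<bar> \<le> w * (2 * m * norm (x - x0) / (R\<^sup>2 * e))"
proof -
  have pos: "e > 0" "w > 0" "r > 0" using max unfolding maximal_triple_def e_def w_def r_def by auto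
  note D = maximal_triple_direction(1)[OF C R t0 max, folded r_def e_def w_def f_def]
  have py: "partial i f y = (w / (2 * r\<^sup>2)) * ((x - y) \<bullet> i)" if "i \<in> Basis" for i
    using D[OF that, of 0 1] by simp
  have px: "partial i f x = (w / (2 * r\<^sup>2)) * ((x - y) \<bullet> i) + (w * (2 * m / (R\<^sup>2 * e))) * ((x - x0) \<bullet> i)"
    if "i \<in> Basis" for i
    using D[OF that, of 1 0] by (simp add: distrib_left)
  have rep: "(\<Sum>i\<in>Basis. (k * (v \<bullet> i)) *\<^sub>R i) = k *\<^sub>R v" for k and v :: 'a
  proof -
    have "(\<Sum>i\<in>Basis. (k * (v \<bullet> i)) *\<^sub>R i) = k *\<^sub>R (\<Sum>i\<in>Basis. (v \<bullet> i) *\<^sub>R i)"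
      by (simp add: scaleR_sum_right)
    then show ?thesis by (simp add: euclidean_representation)
  qed
  have gy: "gradient f y = (w / (2 * r\<^sup>2)) *\<^sub>R (x - y)"
    unfolding gradient_def by (subst rep[symmetric], intro sum.cong) (simp_all only: py)
  have "gradient f x = (\<Sum>i\<in>Basis. ((w / (2 * r\<^sup>2)) * ((x - y) \<bullet> i)) *\<^sub>R i
      + ((w * (2 * m / (R\<^sup>2 * e))) * ((x - x0) \<bullet> i)) *\<^sub>R i)"
    unfolding gradient_def by (intro sum.cong refl) (simp only: px scaleR_add_left)
  then have gx: "gradient f x = gradient f y + (w * (2 * m / (R\<^sup>2 * e))) *\<^sub>R (x - x0)"
    unfolding gy sum.distrib rep .
  show ny: "norm (gradient f y) = w / (2 * r)"
    unfolding gy using pos by (simp add: r_def[symmetric] power2_eq_square)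
  have "\<bar>norm (gradient f x) - norm (gradient f y)\<bar> \<le> norm (gradient f x - gradient f y)"
    by (rule norm_triangle_ineq3)
  also have "\<dots> = w * (2 * m * norm (x - x0) / (R\<^sup>2 * e))"
    unfolding gx using pos m by (simp add: abs_mult)
  finally show "\<bar>norm (gradient f x) - w / (2 * r)\<bar> \<le> w * (2 * m * norm (x - x0) / (R\<^sup>2 * e))"
    unfolding ny .
qed

text \<open>The second-order conditions are summed over the basis, with \<open>x\<close> moving
  \<open>1 + c\<close> times as fast as \<open>y\<close>. For \<open>c = 0\<close> the motion is
  parallel and the distance does not change; for \<open>c = -1\<close> the point \<open>x\<close>,
  and with it the cutoff, stays fixed.\<close>

lemma maximal_triple_laplacians:
  fixes u :: "'a::euclidean_space \<Rightarrow> real \<Rightarrow> real"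
  assumes C: "C21 u" and R: "R > 0" and t0: "t0 < 0" and m: "m \<ge> 0"
    and max: "maximal_triple m R x0 t0 u x y t" and c: "- 1 \<le> c" "c \<le> 0"
  defines "r \<equiv> norm (x - y)" and "e \<equiv> cutoff R x0 t0 x t" and "w \<equiv> u x t - u y t"
    and "f \<equiv> \<lambda>x. u x t"
  defines "P \<equiv> w / (2 * r)" and "A \<equiv> 2 * m * norm (x - x0) / (R\<^sup>2 * e)"
  shows "(1 + c)\<^sup>2 * laplacian f x - laplacian f y
    \<le> c\<^sup>2 * (real DIM('a) * P / r) + 2 * (- c) * (1 + c) * P * A
       + (1 + c)\<^sup>2 * w * (A\<^sup>2 + 2 * m * real DIM('a) / (R\<^sup>2 * e) + 4 * m * (norm (x - x0))\<^sup>2 / (R^4 * e\<^sup>2))"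
proof -
  have pos: "e > 0" "w > 0" "r > 0" using max unfolding maximal_triple_def e_def w_def r_def by auto
  define a where "a = 1 + c"
  define \<tau> where "\<tau> = 2 * m / (R\<^sup>2 * e)"
  define k where "k = 4 * m / (R^4 * e\<^sup>2)"
  define N where "N = real DIM('a)"
  have \<tau>: "\<tau> \<ge> 0" unfolding \<tau>_def using m pos by simp
  have "a\<^sup>2 * laplacian f x - laplacian f y
      = (\<Sum>i\<in>Basis. a\<^sup>2 * partial i (partial i f) x - 1\<^sup>2 * partial i (partial i f) y)"
    unfolding laplacian_def by (simp add: sum_subtractf sum_distrib_left)
  also have "\<dots> \<le> (\<Sum>i\<in>Basis. w * (c\<^sup>2 / (2 * r\<^sup>2) + a\<^sup>2 * \<tau> - (3/4) * c\<^sup>2 / r^4 * ((x - y) \<bullet> i)\<^sup>2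
      + (a\<^sup>2 * k + a\<^sup>2 * \<tau>\<^sup>2) * ((x - x0) \<bullet> i)\<^sup>2 + (a * c * \<tau> / r\<^sup>2) * (((x - y) \<bullet> i) * ((x - x0) \<bullet> i))))"
  proof (intro sum_mono)
    fix i :: 'a assume i: "i \<in> Basis"
    define \<rho> z where "\<rho> = (x - y) \<bullet> i" and "z = (x - x0) \<bullet> i"
    have ac: "a - 1 = c" unfolding a_def by simp
    have t: "2 * m * a * z / (R\<^sup>2 * e) = a * \<tau> * z" "2 * m / (R\<^sup>2 * e) = \<tau>" "4 * m * z\<^sup>2 / (R^4 * e\<^sup>2) = k * z\<^sup>2"
      unfolding \<tau>_def k_def by simp_all
    have "a\<^sup>2 * partial i (partial i f) x - 1\<^sup>2 * partial i (partial i f) y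
      \<le> w * (c\<^sup>2 / (2 * r\<^sup>2) - c\<^sup>2 * \<rho>\<^sup>2 / r^4 + a\<^sup>2 * (\<tau> + k * z\<^sup>2) + (c * \<rho> / (2 * r\<^sup>2) + a * \<tau> * z)\<^sup>2)"
      using maximal_triple_direction(2)[OF C R t0 max i, of a 1, folded r_def e_def w_def f_def \<rho>_def z_def]
      unfolding ac t .
    \<comment> \<open>The second derivative of the logarithmic distance term contributes -1 times
      \<open>c\<^sup>2 * \<rho>\<^sup>2 / r^4\<close> and the square of its first derivative 1/4
      times it, which leaves -3/4.\<close>
    also have "c\<^sup>2 / (2 * r\<^sup>2) - c\<^sup>2 * \<rho>\<^sup>2 / r^4 + a\<^sup>2 * (\<tau> + k * z\<^sup>2) + (c * \<rho> / (2 * r\<^sup>2) + a * \<tau> * z)\<^sup>2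
      = c\<^sup>2 / (2 * r\<^sup>2) + a\<^sup>2 * \<tau> - (3/4) * c\<^sup>2 / r^4 * \<rho>\<^sup>2
      + (a\<^sup>2 * k + a\<^sup>2 * \<tau>\<^sup>2) * z\<^sup>2 + (a * c * \<tau> / r\<^sup>2) * (\<rho> * z)"
    proof -
      have e: "(c * \<rho> / (2 * r\<^sup>2) + a * \<tau> * z)\<^sup>2
          = (1/4) * (c\<^sup>2 * \<rho>\<^sup>2 / r^4) + a\<^sup>2 * \<tau>\<^sup>2 * z\<^sup>2 + (a * c * \<tau> / r\<^sup>2) * (\<rho> * z)"
        unfolding power2_sum by (simp add: power_mult_distrib power_divide)
      have f: "(3/4) * c\<^sup>2 / r^4 * \<rho>\<^sup>2 = (3/4) * (c\<^sup>2 * \<rho>\<^sup>2 / r^4)" by simp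
      have gen: "b - v + a2 * (s + k * z2) + ((1/4) * v + a2 * t2 * z2 + d)
          = b + a2 * s - (3/4) * v + (a2 * k + a2 * t2) * z2 + d" for b v a2 s k z2 t2 d :: real
        by (simp add: algebra_simps)
      show ?thesis unfolding e f by (rule gen)
    qed
    finally show "a\<^sup>2 * partial i (partial i f) x - 1\<^sup>2 * partial i (partial i f) y
      \<le> w * (c\<^sup>2 / (2 * r\<^sup>2) + a\<^sup>2 * \<tau> - (3/4) * c\<^sup>2 / r^4 * ((x - y) \<bullet> i)\<^sup>2
      + (a\<^sup>2 * k + a\<^sup>2 * \<tau>\<^sup>2) * ((x - x0) \<bullet> i)\<^sup>2 + (a * c * \<tau> / r\<^sup>2) * (((x - y) \<bullet> i) * ((x - x0) \<bullet> i)))"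
      unfolding \<rho>_def z_def .
  qed
  also have "\<dots> = w * (N * (c\<^sup>2 / (2 * r\<^sup>2) + a\<^sup>2 * \<tau>) - (3/4) * c\<^sup>2 / r^4 * r\<^sup>2
      + (a\<^sup>2 * k + a\<^sup>2 * \<tau>\<^sup>2) * (norm (x - x0))\<^sup>2 + (a * c * \<tau> / r\<^sup>2) * ((x - y) \<bullet> (x - x0)))"
    unfolding N_def r_def by (rule sum_Basis_quadratic)
  \<comment> \<open>The favourable term with 3/4 is dropped; the cross term, whose coefficient has
    the sign of \<open>a * c \<le> 0\<close>, is bounded by Cauchy-Schwarz.\<close>
  also have "\<dots> \<le> w * (N * (c\<^sup>2 / (2 * r\<^sup>2) + a\<^sup>2 * \<tau>)
      + (a\<^sup>2 * k + a\<^sup>2 * \<tau>\<^sup>2) * (norm (x - x0))\<^sup>2 + (a * (- c) * \<tau> / r\<^sup>2) * (r * norm (x - x0)))"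
  proof (rule mult_left_mono)
    have "- ((x - y) \<bullet> (x - x0)) \<le> r * norm (x - x0)"
      using Cauchy_Schwarz_ineq2[of "x - y" "x - x0"] unfolding r_def by linarith
    moreover have "0 \<le> a * (- c) * \<tau> / r\<^sup>2"
      using c \<tau> by (intro divide_nonneg_nonneg mult_nonneg_nonneg) (auto simp: a_def)
    ultimately have "(a * (- c) * \<tau> / r\<^sup>2) * (- ((x - y) \<bullet> (x - x0))) \<le> (a * (- c) * \<tau> / r\<^sup>2) * (r * norm (x - x0))"
      by (rule mult_left_mono)
    then have le: "(a * c * \<tau> / r\<^sup>2) * ((x - y) \<bullet> (x - x0)) \<le> (a * (- c) * \<tau> / r\<^sup>2) * (r * norm (x - x0))"
      by simp
    have gen: "b - b' + d + v \<le> b + d + v'" if "0 \<le> b'" "v \<le> v'" for b b' d v v' :: real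
      using that by simp
    show "N * (c\<^sup>2 / (2 * r\<^sup>2) + a\<^sup>2 * \<tau>) - (3/4) * c\<^sup>2 / r^4 * r\<^sup>2
      + (a\<^sup>2 * k + a\<^sup>2 * \<tau>\<^sup>2) * (norm (x - x0))\<^sup>2 + (a * c * \<tau> / r\<^sup>2) * ((x - y) \<bullet> (x - x0))
      \<le> N * (c\<^sup>2 / (2 * r\<^sup>2) + a\<^sup>2 * \<tau>)
      + (a\<^sup>2 * k + a\<^sup>2 * \<tau>\<^sup>2) * (norm (x - x0))\<^sup>2 + (a * (- c) * \<tau> / r\<^sup>2) * (r * norm (x - x0))"
      by (rule gen[OF _ le]) simp
  qed (use pos in simp)
  also have "\<dots> = c\<^sup>2 * (N * P / r) + 2 * (- c) * a * P * A
       + a\<^sup>2 * w * (A\<^sup>2 + \<tau> * N + k * (norm (x - x0))\<^sup>2)"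
  proof -
    have A: "A = \<tau> * norm (x - x0)" unfolding A_def \<tau>_def by simp
    have Pr: "P / r = w / (2 * r\<^sup>2)" unfolding P_def by (simp add: power2_eq_square)
    have 1: "w * (N * (c\<^sup>2 / (2 * r\<^sup>2))) = c\<^sup>2 * (N * P / r)"
      unfolding times_divide_eq_right[symmetric] Pr by simp
    have 2: "w * ((a * (- c) * \<tau> / r\<^sup>2) * (r * norm (x - x0))) = 2 * (- c) * a * P * A"
      unfolding P_def A using pos by (simp add: power2_eq_square)
    have 3: "A\<^sup>2 = \<tau>\<^sup>2 * (norm (x - x0))\<^sup>2" unfolding A by (rule power_mult_distrib)
    have "w * (N * (b + a\<^sup>2 * \<tau>) + (a\<^sup>2 * k + a\<^sup>2 * \<tau>\<^sup>2) * n + d)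
        = w * (N * b) + w * d + a\<^sup>2 * w * (\<tau>\<^sup>2 * n + \<tau> * N + k * n)" for b n d
      by (simp add: algebra_simps)
    from this[of "c\<^sup>2 / (2 * r\<^sup>2)" "(norm (x - x0))\<^sup>2" "(a * (- c) * \<tau> / r\<^sup>2) * (r * norm (x - x0))"]
    show ?thesis unfolding 1 2 3 .
  qed
  also have "\<tau> * N = 2 * m * N / (R\<^sup>2 * e)" unfolding \<tau>_def by simp
  also have "k * (norm (x - x0))\<^sup>2 = 4 * m * (norm (x - x0))\<^sup>2 / (R^4 * e\<^sup>2)" unfolding k_def by simp
  finally show ?thesis unfolding a_def N_def .
qed

section \<open>Existence of a maximum\<close>

text \<open>The first partial derivatives are bounded on compact sets. Passing from \<open>x\<close>
  to \<open>x + h\<close> one coordinate at a time, the mean value theorem turns this into a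
  Lipschitz bound uniform in \<open>t\<close>.\<close>

lemma C21_locally_lipschitz:
  fixes u :: "'a::euclidean_space \<Rightarrow> real \<Rightarrow> real"
  assumes C: "C21 u" and I: "compact I" "I \<subseteq> {..<0}"
  shows "\<exists>L\<ge>0. \<forall>t\<in>I. \<forall>x\<in>cball x0 a. \<forall>h. norm h \<le> 1 \<longrightarrow> \<bar>u (x + h) t - u x t\<bar> \<le> L * norm h"
proof -
  \<comment> \<open>Points on the coordinate path deviate from \<open>x\<close> by at most the sum
    of the \<open>\<bar>h \<bullet> j\<bar>\<close>, hence by at most \<open>DIM('a)\<close>; the
    ball is enlarged accordingly.\<close>
  define K where "K = cball x0 (a + real DIM('a)) \<times> I"
  have K: "compact K" "K \<subseteq> past" using I unfolding K_def past_def by (auto intro: compact_Times)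
  have "\<exists>b. \<forall>z\<in>K. \<bar>(\<lambda>(x, t). partial i (\<lambda>y. u y t) x) z\<bar> \<le> b" if "i \<in> Basis" for i
  proof -
    have "continuous_on K (\<lambda>(x, t). partial i (\<lambda>y. u y t) x)"
      using C K that continuous_on_subset unfolding C21_def by blast
    from compact_imp_bounded[OF compact_continuous_image[OF this K(1)]]
    show ?thesis unfolding bounded_iff by auto
  qed
  then obtain b where b: "\<And>i z. i \<in> Basis \<Longrightarrow> z \<in> K \<Longrightarrow> \<bar>(\<lambda>(x, t). partial i (\<lambda>y. u y t) x) z\<bar> \<le> b i"
    by metis
  define B where "B = (\<Sum>i\<in>Basis. \<bar>b i\<bar>)"
  have B0: "B \<ge> 0" unfolding B_def by (simp add: sum_nonneg)
  have B: "\<bar>partial i (\<lambda>y. u y t) x\<bar> \<le> B" if "i \<in> Basis" "(x, t) \<in> K" for i x t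
  proof -
    have "\<bar>b i\<bar> \<le> B" unfolding B_def using that(1) by (intro member_le_sum) auto
    with b[OF that] show ?thesis by auto
  qed
  have "\<bar>u (x + h) t - u x t\<bar> \<le> (B * real DIM('a)) * norm h"
    if t: "t \<in> I" and x: "x \<in> cball x0 a" and h: "norm h \<le> 1" for x h t
  proof -
    have hj: "\<bar>h \<bullet> j\<bar> \<le> 1" "\<bar>h \<bullet> j\<bar> \<le> norm h" if "j \<in> Basis" for j
      using that h Basis_le_norm[of j h] by auto
    \<comment> \<open>\<open>A\<close> is the set of coordinates already moved.\<close>
    have "\<bar>u (x + (\<Sum>j\<in>A. (h \<bullet> j) *\<^sub>R j)) t - u x t\<bar> \<le> (\<Sum>j\<in>A. B * \<bar>h \<bullet> j\<bar>)"
      if "A \<subseteq> Basis" for A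
      using finite_subset[OF that finite_Basis] that
    proof (induction A rule: finite_induct)
      case (insert i A)
      define v where "v = x + (\<Sum>j\<in>A. (h \<bullet> j) *\<^sub>R j)"
      define g where "g = (\<lambda>s. u (v + ((h \<bullet> i) * s) *\<^sub>R i) t)"
      have i: "i \<in> Basis" and A: "A \<subseteq> Basis" using insert by auto
      have pd: "partially_differentiable i (\<lambda>y. u y t) z" for z
        using C I t i unfolding C21_def by blast
      have dg: "(g has_real_derivative (h \<bullet> i) * partial i (\<lambda>y. u y t) (v + ((h \<bullet> i) * s) *\<^sub>R i)) (at s)" for s
        unfolding g_def by (rule partial_line[OF pd])
      obtain s where s: "0 < s" "s < 1"
        "g 1 - g 0 = (1 - 0) * ((h \<bullet> i) * partial i (\<lambda>y. u y t) (v + ((h \<bullet> i) * s) *\<^sub>R i))"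
        using MVT2[of 0 1 g, OF _ dg] by auto
      have "norm (v - x) \<le> (\<Sum>j\<in>A. \<bar>h \<bullet> j\<bar>)"
        unfolding v_def using A norm_sum[of "\<lambda>j. (h \<bullet> j) *\<^sub>R j" A]
        by (simp add: subset_iff)
      moreover have "norm (((h \<bullet> i) * s) *\<^sub>R i) \<le> \<bar>h \<bullet> i\<bar>"
        using s i mult_left_le[of s "\<bar>h \<bullet> i\<bar>"] by (simp add: abs_mult)
      moreover have "(\<Sum>j\<in>A. \<bar>h \<bullet> j\<bar>) + \<bar>h \<bullet> i\<bar> \<le> real DIM('a)"
      proof -
        have "(\<Sum>j\<in>A. \<bar>h \<bullet> j\<bar>) + \<bar>h \<bullet> i\<bar> = (\<Sum>j\<in>insert i A. \<bar>h \<bullet> j\<bar>)" using insert by simp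
        also have "\<dots> \<le> (\<Sum>j\<in>Basis. \<bar>h \<bullet> j\<bar>)" using insert by (intro sum_mono2) auto
        also have "\<dots> \<le> (\<Sum>j\<in>(Basis::'a set). 1)" using hj by (intro sum_mono) auto
        finally show ?thesis by simp
      qed
      moreover have "norm (x - x0) \<le> a" using x by (simp add: dist_norm norm_minus_commute)
      ultimately have "norm ((v + ((h \<bullet> i) * s) *\<^sub>R i) - x0) \<le> a + real DIM('a)"
        using norm_triangle_ineq[of "v - x" "((h \<bullet> i) * s) *\<^sub>R i"]
          norm_triangle_ineq[of "(v - x) + ((h \<bullet> i) * s) *\<^sub>R i" "x - x0"] by (simp add: algebra_simps)
      then have "(v + ((h \<bullet> i) * s) *\<^sub>R i, t) \<in> K"
        using t unfolding K_def by (simp add: dist_norm norm_minus_commute)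
      from mult_left_mono[OF B[OF i this], of "\<bar>h \<bullet> i\<bar>"] have "\<bar>g 1 - g 0\<bar> \<le> B * \<bar>h \<bullet> i\<bar>"
        unfolding s(3) by (simp add: abs_mult mult.commute)
      moreover have "\<bar>g 0 - u x t\<bar> \<le> (\<Sum>j\<in>A. B * \<bar>h \<bullet> j\<bar>)"
        using insert.IH[OF A] unfolding g_def v_def by simp
      moreover have "g 1 = u (x + (\<Sum>j\<in>insert i A. (h \<bullet> j) *\<^sub>R j)) t"
        unfolding g_def v_def using insert by (simp add: algebra_simps)
      ultimately show ?case using insert by simp
    qed simp
    from this[of Basis] have "\<bar>u (x + h) t - u x t\<bar> \<le> (\<Sum>j\<in>Basis. B * \<bar>h \<bullet> j\<bar>)"
      by (simp add: euclidean_representation)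
    also have "\<dots> \<le> (\<Sum>j\<in>(Basis::'a set). B * norm h)" using hj B0 by (intro sum_mono mult_left_mono) auto
    finally show ?thesis by (simp add: algebra_simps)
  qed
  then show ?thesis using B0 by (intro exI[of _ "B * real DIM('a)"]) auto
qed

lemma cutoff_pos_imp_norm_le:
  assumes "R > 0" "0 < cutoff R x0 t0 x t" "t \<le> t0"
  shows "norm (x - x0) \<le> R"
proof -
  have "(norm (x - x0))\<^sup>2 + (t0 - t) < R\<^sup>2" using assms unfolding cutoff_def by (simp add: field_simps)
  then have "(norm (x - x0))\<^sup>2 \<le> R\<^sup>2" using assms(3) by linarith
  then show ?thesis using assms(1) power2_le_imp_le[of "norm (x - x0)" R] by simp
qed

lemma cutoff_pos_imp_time_ge:
  assumes "R > 0" "0 < cutoff R x0 t0 x t"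
  shows "t0 - R\<^sup>2 \<le> t"
proof -
  have "(norm (x - x0))\<^sup>2 + (t0 - t) < R\<^sup>2" using assms unfolding cutoff_def by (simp add: field_simps)
  then show ?thesis using zero_le_power2[of "norm (x - x0)"] by linarith
qed

text \<open>Triples whose quotient is at least its value \<open>Q0 > 0\<close> at
  \<open>(x0, y0, t0)\<close> stay in a compact set off the diagonal: a large distance is excluded
  by the bounded numerator, a small one because a Lipschitz bound beats the exponent 1/2. On that
  set the quotient is continuous and attains its maximum.\<close>

lemma maximal_triple_exists:
  fixes u :: "'a::euclidean_space \<Rightarrow> real \<Rightarrow> real"
  assumes C: "C21 u" and nonneg: "\<And>x t. t < 0 \<Longrightarrow> 0 \<le> u x t"
    and R: "R > 0" and m: "m > 0" and t0: "t0 < 0" and less: "u y0 t0 < u x0 t0"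
  shows "\<exists>x y t. maximal_triple m R x0 t0 u x y t"
proof -
  define Q where "Q = holder_quotient m R x0 t0 u"
  define I where "I = {t0 - R\<^sup>2..t0}"
  have I: "compact I" "I \<subseteq> {..<0}" using t0 unfolding I_def by auto
  have xy0: "x0 \<noteq> y0" using less by auto
  have c0: "cutoff R x0 t0 x0 t0 = 1" unfolding cutoff_def by simp
  define Q0 where "Q0 = Q x0 y0 t0"
  have Q0: "Q0 > 0" unfolding Q0_def Q_def holder_quotient_def c0 using less xy0 by simp
  have dom: "x \<in> cball x0 R \<and> t \<in> I" if "0 < cutoff R x0 t0 x t" "t \<le> t0" for x t
    using cutoff_pos_imp_norm_le[OF R that] cutoff_pos_imp_time_ge[OF R that(1)] that
    unfolding I_def by (simp add: dist_norm norm_minus_commute[of x0 x])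
  have cut1: "cutoff R x0 t0 x t \<le> 1" if "t \<le> t0" for x t
    using that R unfolding cutoff_def by simp
  have "compact (cball x0 R \<times> I)" "cball x0 R \<times> I \<subseteq> past" using I unfolding past_def by (auto intro: compact_Times)
  moreover have cu: "continuous_on past (\<lambda>(x, t). u x t)" using C unfolding C21_def by blast
  ultimately have "bounded ((\<lambda>(x, t). u x t) ` (cball x0 R \<times> I))"
    by (meson compact_continuous_image compact_imp_bounded continuous_on_subset)
  then obtain b where b: "\<And>x t. x \<in> cball x0 R \<Longrightarrow> t \<in> I \<Longrightarrow> \<bar>u x t\<bar> \<le> b" "b > 0"
    unfolding bounded_pos by fastforce
  obtain L where L: "L \<ge> 0" "\<And>t x h. t \<in> I \<Longrightarrow> x \<in> cball x0 R \<Longrightarrow> norm h \<le> 1 \<Longrightarrow> \<bar>u (x + h) t - u x t\<bar> \<le> L * norm h"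
    using C21_locally_lipschitz[OF C I, of x0 R] by blast
  \<comment> \<open>From \<open>Q0 * sqrt r \<le> L * r\<close> follows a lower bound on
    \<open>r\<close>. \<open>L + 1\<close> avoids a division by 0, and the minimum with 1 respects
    the range of the Lipschitz bound.\<close>
  define \<delta> where "\<delta> = min 1 ((Q0 / (L + 1))\<^sup>2)"
  have \<delta>: "\<delta> > 0" unfolding \<delta>_def using Q0 L by simp
  \<comment> \<open>From \<open>Q0 * sqrt r \<le> u x t - u y t \<le> b\<close>, where
    \<open>u y t \<ge> 0\<close>.\<close>
  define \<rho> where "\<rho> = (b / Q0)\<^sup>2"
  have le: "Q x y t \<le> (u x t - u y t) / sqrt (norm (x - y))"
    if "t \<le> t0" "0 < cutoff R x0 t0 x t" "u y t \<le> u x t" for x y t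
  proof -
    have "cutoff R x0 t0 x t powr m \<le> 1" using cut1 that m by (intro powr_le1) auto
    from mult_right_mono[OF this, of "u x t - u y t"] that(3)
    show ?thesis unfolding Q_def holder_quotient_def by (simp add: divide_right_mono)
  qed
  have near: "\<delta> \<le> norm (x - y) \<and> norm (x - y) \<le> \<rho>"
    if d: "t \<le> t0" "x \<noteq> y" "0 < cutoff R x0 t0 x t" and Q: "Q0 \<le> Q x y t" for x y t
  proof -
    define r where "r = norm (x - y)"
    have r: "r > 0" using d unfolding r_def by simp
    have "u y t < u x t"
    proof (rule ccontr)
      assume "\<not> u y t < u x t"
      then have "Q x y t \<le> 0" unfolding Q_def holder_quotient_def by (auto intro!: divide_nonpos_nonneg mult_nonneg_nonpos)
      with Q Q0 show False by simp
    qed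
    then have w: "Q0 \<le> (u x t - u y t) / sqrt r" using le[of t x y] d Q unfolding r_def by linarith
    then have w': "Q0 * sqrt r \<le> u x t - u y t" using r by (simp add: pos_le_divide_eq)
    have xt: "x \<in> cball x0 R" "t \<in> I" using dom d by auto
    have "t < 0" using d t0 by simp
    then have "Q0 * sqrt r \<le> b" using w' b(1)[OF xt] nonneg[of t y] by linarith
    then have "sqrt r \<le> b / Q0" using Q0 by (simp add: field_simps)
    then have "r \<le> \<rho>" unfolding \<rho>_def using r by (simp add: sqrt_le_D)
    moreover have "\<delta> \<le> r"
    proof (rule ccontr)
      assume "\<not> \<delta> \<le> r"
      then have r1: "r < 1" "r < (Q0 / (L + 1))\<^sup>2" unfolding \<delta>_def by auto
      have "u x t - u y t \<le> L * r"
        using L(2)[OF xt(2,1), of "y - x"] r1 unfolding r_def by (auto simp: norm_minus_commute)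
      also have "\<dots> = L * sqrt r * sqrt r" using r by simp
      finally have "Q0 * sqrt r \<le> (L * sqrt r) * sqrt r" using w' by linarith
      then have "Q0 \<le> L * sqrt r" using r by simp
      also have "\<dots> \<le> (L + 1) * sqrt r" using r by (intro mult_right_mono) auto
      also have "sqrt r < Q0 / (L + 1)" using r1 Q0 L by (intro real_less_lsqrt) auto
      then have "(L + 1) * sqrt r < Q0" using L by (simp add: field_simps)
      finally show False by simp
    qed
    ultimately show ?thesis unfolding r_def by simp
  qed
  \<comment> \<open>For closedness the cutoff may vanish on \<open>K\<close>. This adds no
    maximiser, since the quotient is 0 there while the maximum is at least
    \<open>Q0 > 0\<close>.\<close>
  define K where "K = (cball x0 R \<times> cball x0 (R + \<rho>) \<times> I) \<inter>
     {z. \<delta> \<le> norm (fst z - fst (snd z))} \<inter> {z. 0 \<le> cutoff R x0 t0 (fst z) (snd (snd z))}"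
  have "compact K" unfolding K_def cutoff_def
    by (intro compact_Int_closed compact_Times I compact_cball closed_Collect_le continuous_intros) (use R in auto)
  moreover have KI: "(x, y, t) \<in> K"
    if "t \<le> t0" "x \<noteq> y" "0 < cutoff R x0 t0 x t" "Q0 \<le> Q x y t" for x y t
  proof -
    have "norm (y - x0) \<le> R + \<rho>"
      using near[OF that] dom[OF that(3,1)] norm_triangle_ineq[of "y - x" "x - x0"]
      by (simp add: dist_norm norm_minus_commute)
    then show ?thesis using near[OF that] dom[OF that(3,1)] that
      unfolding K_def by (simp add: dist_norm norm_minus_commute)
  qed
  then have k0: "(x0, y0, t0) \<in> K" using xy0 c0 by (simp add: Q0_def)
  moreover have "continuous_on K (\<lambda>z. Q (fst z) (fst (snd z)) (snd (snd z)))"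
  proof -
    have K': "fst z - fst (snd z) \<noteq> 0" "snd (snd z) < 0" "0 \<le> cutoff R x0 t0 (fst z) (snd (snd z))" if "z \<in> K" for z
      using that \<delta> I unfolding K_def by auto
    have 1: "continuous_on K (\<lambda>z. u (fst z) (snd (snd z)))"
    proof -
      have "continuous_on K (\<lambda>z. (fst z, snd (snd z)))" by (intro continuous_intros)
      moreover have "(\<lambda>z. (fst z, snd (snd z))) ` K \<subseteq> past" using K'(2) unfolding past_def by auto
      ultimately show ?thesis using continuous_on_compose2[OF cu, of K "\<lambda>z. (fst z, snd (snd z))"] by simp
    qed
    have 2: "continuous_on K (\<lambda>z. u (fst (snd z)) (snd (snd z)))"
    proof -
      have "continuous_on K (\<lambda>z. (fst (snd z), snd (snd z)))" by (intro continuous_intros)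
      moreover have "(\<lambda>z. (fst (snd z), snd (snd z))) ` K \<subseteq> past" using K'(2) unfolding past_def by auto
      ultimately show ?thesis using continuous_on_compose2[OF cu, of K "\<lambda>z. (fst (snd z), snd (snd z))"]
        by (simp add: case_prod_unfold)
    qed
    have 3: "continuous_on K (\<lambda>z. cutoff R x0 t0 (fst z) (snd (snd z)))"
      unfolding cutoff_def using R by (intro continuous_intros) auto
    show ?thesis unfolding Q_def holder_quotient_def
      using K' m by (intro continuous_intros continuous_on_powr' 1 2 3) (auto simp: continuous_on_const)
  qed
  ultimately obtain z where z: "z \<in> K"
    "\<And>z'. z' \<in> K \<Longrightarrow> Q (fst z') (fst (snd z')) (snd (snd z')) \<le> Q (fst z) (fst (snd z)) (snd (snd z))"
    using continuous_attains_sup[of K] by blast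
  obtain x y t where xyt: "z = (x, y, t)" by (cases z)
  have Qz: "Q0 \<le> Q x y t" using z(2)[OF k0] unfolding xyt Q0_def by simp
  have cz: "0 \<le> cutoff R x0 t0 x t" "t \<le> t0" "x \<noteq> y" using z(1) \<delta> unfolding xyt K_def I_def by auto
  have "cutoff R x0 t0 x t \<noteq> 0" using Qz Q0 m unfolding Q_def holder_quotient_def by auto
  moreover have "u y t < u x t"
  proof (rule ccontr)
    assume "\<not> u y t < u x t"
    then have "Q x y t \<le> 0" unfolding Q_def holder_quotient_def by (auto intro!: divide_nonpos_nonneg mult_nonneg_nonpos)
    with Qz Q0 show False by simp
  qed
  moreover have "Q x' y' t' \<le> Q x y t" if "t' \<le> t0" "x' \<noteq> y'" "0 < cutoff R x0 t0 x' t'" for x' y' t'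
  proof (cases "Q0 \<le> Q x' y' t'")
    case True
    then show ?thesis using z(2)[OF KI[OF that True]] unfolding xyt by simp
  next
    case False
    then show ?thesis using Qz by simp
  qed
  ultimately have "maximal_triple m R x0 t0 u x y t"
    using cz unfolding maximal_triple_def Q_def by auto
  then show ?thesis by blast
qed

section \<open>Decay of the maximum\<close>

text \<open>The equation and the sign of the time derivative bound each Laplacian by minus the
  right-hand side. The Laplacian estimate with \<open>c = -1\<close> then gives the first
  inequality. For the second, the equations at \<open>x\<close> and \<open>y\<close> are subtracted,
  the time derivatives are compared by \<open>maximal_triple_time\<close>, and \<open>c\<close> is
  optimised.\<close>

lemma maximal_triple_inequalities:
  fixes u :: "'a::euclidean_space \<Rightarrow> real \<Rightarrow> real"
  assumes M: "M > 0"
    and sol: "classical_solution p q M u"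
    and nonneg: "\<And>x t. t < 0 \<Longrightarrow> 0 \<le> u x t"
    and mono: "\<And>x t. t < 0 \<Longrightarrow> time_deriv u x t \<le> 0"
    and R: "R > 0" and t0: "t0 < 0" and m: "m \<ge> 0"
    and max: "maximal_triple m R x0 t0 u x y t"
  defines "N \<equiv> real DIM('a)" and "r \<equiv> norm (x - y)" and "w \<equiv> u x t - u y t"
    and "e \<equiv> cutoff R x0 t0 x t" and "G \<equiv> norm (gradient (\<lambda>x. u x t) x)"
  defines "P \<equiv> w / (2 * r)" and "E \<equiv> u x t powr p + M * G powr q"
    and "A \<equiv> 2 * m * norm (x - x0) / (R\<^sup>2 * e)"
  shows "M * P powr q \<le> N * P / r"
    and "E\<^sup>2 \<le> (E + N * P / r) * (u x t powr p - u y t powr p + M * (G powr q - P powr q)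
        + w * (A\<^sup>2 + 2 * m * N / (R\<^sup>2 * e) + 4 * m * (norm (x - x0))\<^sup>2 / (R^4 * e\<^sup>2) + m / (R\<^sup>2 * e)))
      + 2 * E * P * A"
proof -
  define f where "f = (\<lambda>x. u x t)"
  define B where "B = A\<^sup>2 + 2 * m * N / (R\<^sup>2 * e) + 4 * m * (norm (x - x0))\<^sup>2 / (R^4 * e\<^sup>2)"
  define X Y where "X = laplacian f x" and "Y = laplacian f y"
  define k where "k = N * P / r"
  define S where "S = u x t powr p - u y t powr p + M * (G powr q - P powr q)"
  have C: "C21 u" using sol unfolding classical_solution_def by blast
  have pos: "e > 0" "w > 0" "r > 0" and t: "t < 0"
    using max t0 unfolding maximal_triple_def e_def w_def r_def by auto
  have P: "P > 0" and k: "k > 0" and A: "A \<ge> 0" and B: "B \<ge> 0"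
    using pos m R unfolding P_def k_def A_def B_def N_def by auto
  have ux: "0 < u x t" using pos nonneg[OF t, of y] unfolding w_def by simp
  have E: "E > 0" unfolding E_def using ux M by (auto intro!: add_pos_nonneg)
  have gy: "norm (gradient f y) = P"
    using maximal_triple_gradients(1)[OF C R t0 m max] unfolding P_def w_def r_def f_def .
  have eqx: "time_deriv u x t - X = E" and eqy: "time_deriv u y t - Y = u y t powr p + M * P powr q"
    using sol t gy unfolding classical_solution_def X_def Y_def E_def G_def f_def by auto
  have lap: "(1 + c)\<^sup>2 * X - Y \<le> c\<^sup>2 * k + 2 * (- c) * (1 + c) * P * A + (1 + c)\<^sup>2 * w * B"
    if "- 1 \<le> c" "c \<le> 0" for c
    using maximal_triple_laplacians[OF C R t0 m max that]
    unfolding X_def Y_def k_def P_def A_def B_def f_def N_def r_def w_def e_def by simp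
  have "M * P powr q \<le> - Y" using eqy mono[OF t, of y] powr_ge_zero[of "u y t" p] by linarith
  also have "\<dots> \<le> k" using lap[of "-1"] by simp
  finally show "M * P powr q \<le> N * P / r" unfolding k_def .
  \<comment> \<open>the minimiser of \<open>c\<^sup>2 k + (2 c + c\<^sup>2) E\<close>\<close>
  define c where "c = - E / (E + k)"
  have c1: "1 + c = k / (E + k)" unfolding c_def using E k by (simp add: field_simps)
  have c: "- 1 \<le> c" "c \<le> 0" "0 \<le> 1 + c" "1 + c \<le> 1" unfolding c1 unfolding c_def using E k by auto
  have Xle: "X \<le> - E" using eqx mono[OF t, of x] by linarith
  have "- w * m / (R\<^sup>2 * e) \<le> time_deriv u x t - time_deriv u y t"
    using maximal_triple_time[OF C R t0 max] unfolding w_def e_def .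
  also have "\<dots> = X - Y + S" using eqx eqy unfolding S_def E_def by (simp add: algebra_simps)
  \<comment> \<open>\<open>lap\<close> controls only the first bracket; the remaining multiple of
    \<open>X\<close> has the nonnegative coefficient \<open>- c * (2 + c)\<close> and is estimated
    by \<open>X \<le> - E\<close>.\<close>
  also have "X - Y = ((1 + c)\<^sup>2 * X - Y) + (- c * (2 + c)) * X" by (simp add: power2_eq_square algebra_simps)
  also have "\<dots> \<le> (c\<^sup>2 * k + 2 * (- c) * P * A + w * B) + (- c * (2 + c)) * (- E)"
  proof (rule add_mono)
    have "0 \<le> - c * (2 + c)" using c by (intro mult_nonneg_nonneg) auto
    with Xle show "(- c * (2 + c)) * X \<le> (- c * (2 + c)) * (- E)" by (rule mult_left_mono)
    have "(1 + c) * (2 * (- c) * P * A) \<le> 1 * (2 * (- c) * P * A)"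
      using c P A by (intro mult_right_mono[OF c(4)] mult_nonneg_nonneg) auto
    moreover have "(1 + c) * (2 * (- c) * P * A) = 2 * (- c) * (1 + c) * P * A" by (simp add: ac_simps)
    moreover have "(1 + c)\<^sup>2 * (w * B) \<le> 1 * (w * B)"
      using c pos B by (intro mult_right_mono power_le_one mult_nonneg_nonneg) auto
    moreover have "(1 + c)\<^sup>2 * (w * B) = (1 + c)\<^sup>2 * w * B" by simp
    ultimately show "(1 + c)\<^sup>2 * X - Y \<le> c\<^sup>2 * k + 2 * (- c) * P * A + w * B"
      using lap[OF c(1,2)] unfolding mult_1 by linarith
  qed
  also have "\<dots> = - (E\<^sup>2 / (E + k)) + 2 * (E / (E + k)) * P * A + w * B"
  proof -
    have "c\<^sup>2 * k + (- c * (2 + c)) * (- E) = c * (c * (E + k) + 2 * E)"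
      by (simp add: power2_eq_square algebra_simps)
    also have "c * (E + k) = - E" unfolding c_def using E k by simp
    also have "c * (- E + 2 * E) = - (E\<^sup>2 / (E + k))" unfolding c_def by (simp add: power2_eq_square)
    finally show ?thesis unfolding c_def by simp
  qed
  finally have "E\<^sup>2 / (E + k) \<le> S + (w * B - - w * m / (R\<^sup>2 * e)) + 2 * (E / (E + k)) * P * A"
    by linarith
  moreover have "w * B - - w * m / (R\<^sup>2 * e) = w * (B + m / (R\<^sup>2 * e))" by (simp add: distrib_left)
  ultimately have "E\<^sup>2 / (E + k) \<le> S + w * (B + m / (R\<^sup>2 * e)) + 2 * (E / (E + k)) * P * A"
    by simp
  then have le: "(E + k) * (E\<^sup>2 / (E + k))
      \<le> (E + k) * (S + w * (B + m / (R\<^sup>2 * e)) + 2 * (E / (E + k)) * P * A)"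
    using E k by (intro mult_left_mono) auto
  have distr: "s * (v + 2 * d * P * A) = s * v + 2 * (s * d) * P * A" for s v d
    by (simp add: distrib_left)
  have canc: "(E + k) * (E\<^sup>2 / (E + k)) = E\<^sup>2" "(E + k) * (E / (E + k)) = E" using E k by simp_all
  have "E\<^sup>2 \<le> (E + k) * (S + w * (B + m / (R\<^sup>2 * e))) + 2 * E * P * A"
    using le unfolding distr canc .
  then show "E\<^sup>2 \<le> (E + N * P / r) * (u x t powr p - u y t powr p + M * (G powr q - P powr q)
        + w * (A\<^sup>2 + 2 * m * N / (R\<^sup>2 * e) + 4 * m * (norm (x - x0))\<^sup>2 / (R^4 * e\<^sup>2) + m / (R\<^sup>2 * e)))
      + 2 * E * P * A"
    unfolding k_def S_def B_def .
qed

text \<open>With \<open>\<sigma> = 1 / (R * e)\<close>, the cutoff errors \<open>A\<close> and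
  \<open>B\<close> are of order \<open>\<sigma>\<close> and \<open>\<sigma>\<^sup>2\<close>, so
  \<open>touching_inequality_fails\<close> forces \<open>h < C * \<sigma>\<close>. Hence
  \<open>w\<close> is at most \<open>h powr (2 / (p - 1))\<close>, and \<open>P\<close> at most a
  constant times \<open>\<sigma>\<close> times that. As \<open>w / sqrt r\<close> is the square root
  of \<open>2 * w * P\<close>, it is of order \<open>\<sigma> powr m\<close>.\<close>

lemma holder_quotient_bound:
  fixes u :: "'a::euclidean_space \<Rightarrow> real \<Rightarrow> real"
  assumes p: "p > 1" and q: "q = 2 * p / (p + 1)" and M: "M > 0"
    and Mbig: "(M powr (1 / q))\<^sup>2 \<ge> 6 * real DIM('a) * (p + 1)"
    and sol: "classical_solution p q M u"
    and nonneg: "\<And>x t. t < 0 \<Longrightarrow> 0 \<le> u x t"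
    and mono: "\<And>x t. t < 0 \<Longrightarrow> time_deriv u x t \<le> 0"
    and R: "R > 0" and t0: "t0 < 0" and m: "m = 2 / (p - 1) + 1 / 2"
    and max: "maximal_triple m R x0 t0 u x y t"
    and \<mu>: "\<mu> = M powr (1 / q)"
    and C: "C = 100 * m * \<mu> + 20 * (4 * m\<^sup>2 + 2 * m * real DIM('a) + 5 * m) + 1"
  shows "holder_quotient m R x0 t0 u x y t
      \<le> C powr (2 / (p - 1)) * sqrt (2 * (C / \<mu> + 2 * m)) * R powr (- m)"
proof -
  define N where "N = real DIM('a)"
  define r w e where "r = norm (x - y)" and "w = u x t - u y t" and "e = cutoff R x0 t0 x t"
  define G where "G = norm (gradient (\<lambda>x. u x t) x)"
  define P where "P = w / (2 * r)"
  define E where "E = u x t powr p + M * G powr q"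
  define h where "h = E powr ((p - 1) / (2 * p))"
  define A where "A = 2 * m * norm (x - x0) / (R\<^sup>2 * e)"
  define B where "B = A\<^sup>2 + 2 * m * N / (R\<^sup>2 * e) + 4 * m * (norm (x - x0))\<^sup>2 / (R^4 * e\<^sup>2) + m / (R\<^sup>2 * e)"
  define \<sigma> where "\<sigma> = 1 / (R * e)"
  have m0: "m > 0" and N1: "N \<ge> 1" and \<mu>0: "\<mu> > 0"
    unfolding m N_def \<mu> using p M by (auto simp: DIM_ge_Suc0 Suc_leI intro!: add_pos_pos)
  have q0: "q > 0" unfolding q using p by simp
  have pos: "e > 0" "w > 0" "r > 0" and t: "t < 0" "t \<le> t0"
    using max t0 unfolding maximal_triple_def e_def w_def r_def by auto
  have e1: "e \<le> 1" using t R unfolding e_def cutoff_def by simp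
  have z: "norm (x - x0) \<le> R" using cutoff_pos_imp_norm_le[OF R] pos t unfolding e_def by blast
  have C21: "C21 u" using sol unfolding classical_solution_def by blast
  have uy: "0 \<le> u y t" and ux: "0 < u x t" using nonneg[OF t(1), of y] pos unfolding w_def by auto
  have \<sigma>: "\<sigma> > 0" unfolding \<sigma>_def using R pos by simp
  have P: "P > 0" unfolding P_def using pos by simp
  have E: "E > 0" unfolding E_def using ux M by (auto intro!: add_pos_nonneg)
  have h: "h > 0" unfolding h_def using E by simp
  have A0: "A \<ge> 0" unfolding A_def using m0 R pos by simp
  have B0: "B \<ge> 0" unfolding B_def using m0 N1 R pos by simp
  have A1: "A \<le> 2 * m * \<sigma>"
  proof -
    have "A \<le> 2 * m * R / (R\<^sup>2 * e)" unfolding A_def using z m0 pos R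
      by (intro divide_right_mono mult_left_mono) auto
    also have "\<dots> = 2 * m * \<sigma>" unfolding \<sigma>_def using R by (simp add: power2_eq_square)
    finally show ?thesis .
  qed
  have s1: "1 / (R\<^sup>2 * e) \<le> \<sigma>\<^sup>2"
  proof -
    have "1 / (R\<^sup>2 * e) = e * \<sigma>\<^sup>2" unfolding \<sigma>_def using R pos by (simp add: power2_eq_square)
    also have "\<dots> \<le> 1 * \<sigma>\<^sup>2" using e1 by (intro mult_right_mono) auto
    finally show ?thesis by simp
  qed
  have B1: "B \<le> (4 * m\<^sup>2 + 2 * m * N + 5 * m) * \<sigma>\<^sup>2"
  proof -
    have "A\<^sup>2 \<le> (2 * m * \<sigma>)\<^sup>2" using A1 A0 by (intro power_mono)
    moreover have "2 * m * N / (R\<^sup>2 * e) \<le> 2 * m * N * \<sigma>\<^sup>2" "m / (R\<^sup>2 * e) \<le> m * \<sigma>\<^sup>2"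
      using mult_left_mono[OF s1, of "2 * m * N"] mult_left_mono[OF s1, of m] m0 N1 by simp_all
    moreover have "4 * m * (norm (x - x0))\<^sup>2 / (R^4 * e\<^sup>2) \<le> 4 * m * \<sigma>\<^sup>2"
    proof -
      have "4 * m * (norm (x - x0))\<^sup>2 / (R^4 * e\<^sup>2) \<le> 4 * m * R\<^sup>2 / (R^4 * e\<^sup>2)"
        using z m0 by (intro divide_right_mono mult_left_mono power_mono) auto
      also have "\<dots> = 4 * m * \<sigma>\<^sup>2"
        unfolding \<sigma>_def using R by (simp add: power4_eq_xxxx power2_eq_square)
      finally show ?thesis .
    qed
    ultimately have "B \<le> (2 * m * \<sigma>)\<^sup>2 + 2 * m * N * \<sigma>\<^sup>2 + 4 * m * \<sigma>\<^sup>2 + m * \<sigma>\<^sup>2"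
      unfolding B_def by (intro add_mono)
    also have "\<dots> = (4 * m\<^sup>2 + 2 * m * N + 5 * m) * \<sigma>\<^sup>2" by (simp add: algebra_simps power2_eq_square)
    finally show ?thesis .
  qed
  have C0: "C \<ge> 1" "C \<ge> 100 * m * \<mu>" "C \<ge> 20 * (4 * m\<^sup>2 + 2 * m * N + 5 * m)"
    unfolding C N_def[symmetric] using m0 \<mu>0 N1 by auto
  have GP: "\<bar>G - P\<bar> \<le> w * A"
    using maximal_triple_gradients(2)[OF C21 R t0 less_imp_le[OF m0] max]
    unfolding G_def P_def A_def w_def r_def e_def .
  note ineqs = maximal_triple_inequalities[OF M sol nonneg mono R t0 less_imp_le[OF m0] max,
      folded N_def r_def w_def e_def G_def, folded P_def E_def A_def, folded B_def]
  have hC: "h < C * \<sigma>"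
  proof (rule ccontr)
    assume "\<not> h < C * \<sigma>"
    then have hC: "C * \<sigma> \<le> h" by simp
    have "50 * M powr (1 / q) * A \<le> 50 * \<mu> * (2 * m * \<sigma>)"
      unfolding \<mu>[symmetric] using A1 \<mu>0 by (intro mult_left_mono) auto
    also have "\<dots> = (100 * m * \<mu>) * \<sigma>" by simp
    also have "\<dots> \<le> C * \<sigma>" using C0 \<sigma> by (intro mult_right_mono) auto
    finally have a: "50 * M powr (1 / q) * A \<le> h" using hC by linarith
    define K where "K = 4 * m\<^sup>2 + 2 * m * N + 5 * m"
    have "20 * B \<le> (20 * K) * \<sigma>\<^sup>2" using B1 unfolding K_def[symmetric] by simp
    also have "\<dots> \<le> C * \<sigma>\<^sup>2" using C0(3) unfolding K_def[symmetric] by (intro mult_right_mono) auto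
    \<comment> \<open>The summand 1 in \<open>C\<close> ensures
      \<open>C \<le> C * C\<close>.\<close>
    also have "\<dots> \<le> C * C * \<sigma>\<^sup>2" using C0 by (intro mult_right_mono) auto
    also have "\<dots> = (C * \<sigma>)\<^sup>2" by (simp add: power2_eq_square)
    also have "\<dots> \<le> h\<^sup>2" using hC C0 \<sigma> by (intro power_mono) auto
    finally have b: "20 * B \<le> h\<^sup>2" .
    show False
      by (rule touching_inequality_fails[OF p q N1 M _ uy _ _ P pos(3) A0 B0 E_def E h_def _ _ ineqs(1) _ a b])
        (use Mbig pos GP ineqs(2) in \<open>auto simp: N_def[symmetric] G_def P_def w_def\<close>)
  qed
  define a where "a = h powr (2 / (p - 1))"
  have aE: "a = E powr (1 / p)"
  proof -
    have "(p - 1) / (2 * p) * (2 / (p - 1)) = 1 / p" using p by (simp add: field_simps)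
    then show ?thesis unfolding a_def h_def powr_powr by simp
  qed
  have "u x t = (u x t powr p) powr (1 / p)" using ux p by (simp add: powr_powr)
  also have "\<dots> \<le> a" unfolding aE E_def using p M by (intro powr_mono2) auto
  finally have wa: "w \<le> a" using uy unfolding w_def by simp
  have a0: "a > 0" unfolding a_def using h by simp
  \<comment> \<open>By scaling \<open>a * h = E powr (1 / q)\<close>, and \<open>E\<close> is at
    least \<open>M * G powr q\<close>.\<close>
  have "\<mu> * G \<le> a * h"
  proof -
    have "(\<mu> * G) powr q = M * G powr q"
      unfolding \<mu> using M q0 by (simp add: powr_mult powr_powr G_def)
    then have "\<mu> * G = (M * G powr q) powr (1 / q)"
      using q0 \<mu>0 by (metis G_def mult_nonneg_nonneg less_imp_le nonzero_divide_eq_eq norm_ge_zero order_less_irrefl powr_one powr_powr times_divide_eq_right mult.right_neutral)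
    also have "\<dots> \<le> E powr (1 / q)" unfolding E_def using q0 M by (intro powr_mono2) auto
    also have "1 / q = 1 / p + (p - 1) / (2 * p)" unfolding q using p by (simp add: field_simps)
    also have "E powr \<dots> = a * h" unfolding aE h_def by (rule powr_add)
    finally show ?thesis .
  qed
  then have "G \<le> a * h / \<mu>" using \<mu>0 by (simp add: field_simps)
  also have "\<dots> \<le> a * (C * \<sigma>) / \<mu>" using hC a0 \<mu>0 by (intro divide_right_mono mult_left_mono) auto
  finally have "G \<le> a * (C * \<sigma>) / \<mu>" .
  moreover have "w * A \<le> a * (2 * m * \<sigma>)" using wa A1 A0 a0 by (intro mult_mono) auto
  ultimately have P1: "P \<le> a * \<sigma> * (C / \<mu> + 2 * m)" using GP by (simp add: algebra_simps)
  \<comment> \<open>The square root of this product is \<open>w / sqrt r\<close>. The factor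
    \<open>\<sigma>\<close> in the bound for \<open>P\<close> comes under the root and accounts for
    the summand 1/2 of \<open>m\<close>.\<close>
  have "w * (w / r) = w * (2 * P)" unfolding P_def by simp
  also have "\<dots> \<le> a * (2 * (a * \<sigma> * (C / \<mu> + 2 * m)))" using wa P1 P pos a0 by (intro mult_mono) auto
  also have "\<dots> = a\<^sup>2 * (\<sigma> * (2 * (C / \<mu> + 2 * m)))" by (simp add: power2_eq_square)
  finally have "sqrt (w * (w / r)) \<le> sqrt (a\<^sup>2 * (\<sigma> * (2 * (C / \<mu> + 2 * m))))" by (rule real_sqrt_le_mono)
  moreover have "sqrt (w * (w / r)) = w / sqrt r"
    using pos by (simp add: real_sqrt_mult real_sqrt_divide)
  moreover have "sqrt (a\<^sup>2 * (\<sigma> * (2 * (C / \<mu> + 2 * m)))) = a * (sqrt \<sigma> * sqrt (2 * (C / \<mu> + 2 * m)))"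
    using a0 by (simp add: real_sqrt_mult)
  ultimately have "w / sqrt r \<le> a * (sqrt \<sigma> * sqrt (2 * (C / \<mu> + 2 * m)))" by (simp only:)
  also have "\<dots> \<le> (C * \<sigma>) powr (2 / (p - 1)) * (sqrt \<sigma> * sqrt (2 * (C / \<mu> + 2 * m)))"
    unfolding a_def using hC h p \<sigma> C0 \<mu>0 m0 by (intro mult_right_mono powr_mono2) auto
  also have "\<dots> = C powr (2 / (p - 1)) * sqrt (2 * (C / \<mu> + 2 * m)) * \<sigma> powr m"
    unfolding m powr_add powr_half_sqrt[OF less_imp_le[OF \<sigma>]]
    using C0 \<sigma> by (simp add: powr_mult)
  finally have "e powr m * (w / sqrt r)
      \<le> e powr m * (C powr (2 / (p - 1)) * sqrt (2 * (C / \<mu> + 2 * m)) * \<sigma> powr m)"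
    by (intro mult_left_mono) auto
  \<comment> \<open>Since \<open>e * \<sigma> = 1 / R\<close>, the exponent \<open>m\<close> of the
    cutoff removes the dependence on where the maximum lies.\<close>
  also have "e powr m * \<sigma> powr m = R powr (- m)"
    unfolding \<sigma>_def using R pos by (simp add: powr_mult powr_divide powr_minus_divide)
  then have "e powr m * (C powr (2 / (p - 1)) * sqrt (2 * (C / \<mu> + 2 * m)) * \<sigma> powr m)
      = C powr (2 / (p - 1)) * sqrt (2 * (C / \<mu> + 2 * m)) * R powr (- m)"
    by (metis mult.left_commute)
  finally show ?thesis unfolding holder_quotient_def e_def w_def r_def by simp
qed

text \<open>With the cutoff centred at \<open>(x, t)\<close>, where it equals 1, the quotient of
  \<open>x\<close> and any \<open>y\<close> is at most the maximum, hence at most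
  \<open>C' * R powr (- m)\<close> for every \<open>R\<close>. Letting \<open>R\<close> grow gives
  \<open>u x t \<le> u y t\<close>, and exchanging the points gives equality.\<close>

lemma ancient_solution_zero:
  fixes u :: "'a::euclidean_space \<Rightarrow> real \<Rightarrow> real"
  assumes p: "p > 1" and q: "q = 2 * p / (p + 1)" and M: "M \<ge> M0 DIM('a) p"
    and sol: "classical_solution p q M u"
    and nonneg: "\<And>x t. t < 0 \<Longrightarrow> 0 \<le> u x t"
    and mono: "\<And>x t. t < 0 \<Longrightarrow> time_deriv u x t \<le> 0"
    and t: "t < 0"
  shows "u x t = 0"
proof -
  define \<mu> where "\<mu> = M powr (1 / q)"
  define N where "N = real DIM('a)"
  have N1: "N \<ge> 1" unfolding N_def by (simp add: DIM_ge_Suc0 Suc_leI)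
  have q0: "q > 0" unfolding q using p by simp
  have "6 * N * (p + 1) > 0" using N1 p by simp
  moreover have "1 \<le> ((p + 1) / (p - 1)) powr (1 / 2)" using p by (intro ge_one_powr_ge_zero) auto
  ultimately have M1: "(6 * N * (p + 1)) powr (p / (p + 1)) \<le> M" "M > 0"
    using M mult_left_mono[of 1 "((p + 1) / (p - 1)) powr (1 / 2)" "(6 * N * (p + 1)) powr (p / (p + 1))"]
      powr_gt_zero[of "6 * N * (p + 1)" "p / (p + 1)"]
    unfolding M0_def N_def[symmetric] by linarith+
  \<comment> \<open>As \<open>(p + 1) / p = 2 / q\<close>, raising the lower bound on
    \<open>M\<close> to this power yields the bound on \<open>\<mu>\<^sup>2\<close>.\<close>
  have \<mu>2: "\<mu>\<^sup>2 \<ge> 6 * N * (p + 1)"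
  proof -
    have "6 * N * (p + 1) = ((6 * N * (p + 1)) powr (p / (p + 1))) powr ((p + 1) / p)"
      using N1 p by (simp add: powr_powr)
    also have "\<dots> \<le> M powr ((p + 1) / p)" using M1 p by (intro powr_mono2) auto
    also have "(p + 1) / p = 1 / q + 1 / q" unfolding q using p by (simp add: field_simps)
    also have "M powr \<dots> = \<mu>\<^sup>2" unfolding \<mu>_def by (simp only: powr_add power2_eq_square)
    finally show ?thesis .
  qed
  define m where "m = 2 / (p - 1) + 1 / 2"
  have m0: "m > 0" unfolding m_def using p by (auto intro!: add_pos_pos)
  define C where "C = 100 * m * \<mu> + 20 * (4 * m\<^sup>2 + 2 * m * N + 5 * m) + 1"
  define C' where "C' = C powr (2 / (p - 1)) * sqrt (2 * (C / \<mu> + 2 * m))"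
  have C21: "C21 u" using sol unfolding classical_solution_def by blast
  have le: "u x t \<le> u y t" for x y
  proof (rule ccontr)
    assume "\<not> u x t \<le> u y t"
    then have less: "u y t < u x t" by simp
    then have xy: "x \<noteq> y" by auto
    have "(u x t - u y t) / sqrt (norm (x - y)) \<le> C' * R powr (- m)" if R: "R > 0" for R
    proof -
      obtain x' y' t' where max: "maximal_triple m R x t u x' y' t'"
        using maximal_triple_exists[OF C21 nonneg R m0 t less] by blast
      have c1: "cutoff R x t x t = 1" unfolding cutoff_def by simp
      have "(u x t - u y t) / sqrt (norm (x - y)) = holder_quotient m R x t u x y t"
        unfolding holder_quotient_def c1 by simp
      also have "\<dots> \<le> holder_quotient m R x t u x' y' t'"
        using max xy c1 unfolding maximal_triple_def by auto
      also have "\<dots> \<le> C' * R powr (- m)"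
        unfolding C'_def
        by (rule holder_quotient_bound[OF p q M1(2) _ sol nonneg mono R t m_def max \<mu>_def])
          (use \<mu>2 in \<open>auto simp: \<mu>_def N_def C_def\<close>)
      finally show ?thesis .
    qed
    then have "\<forall>\<^sub>F R in at_top. (u x t - u y t) / sqrt (norm (x - y)) \<le> C' * R powr (- m)"
      by (intro eventually_mono[OF eventually_gt_at_top[of 0]])
    moreover have "((\<lambda>R. C' * R powr (- m)) \<longlongrightarrow> C' * 0) at_top"
      using m0 by (intro tendsto_mult_left tendsto_neg_powr filterlim_ident) auto
    ultimately have "(u x t - u y t) / sqrt (norm (x - y)) \<le> C' * 0"
      using tendsto_lowerbound trivial_limit_at_top_linorder by blast
    then show False using less xy by (simp add: divide_le_0_iff)
  qed
  \<comment> \<open>Constancy in space removes gradient and Laplacian; the time derivative then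
    equals \<open>u x t powr p \<ge> 0\<close>, and \<open>mono\<close> forces it to be 0.\<close>
  define k where "k = u x t"
  have const: "(\<lambda>y. u y t) = (\<lambda>y. k)" unfolding k_def using le by (intro ext antisym) auto
  have pk: "partial i (\<lambda>y. c) = (\<lambda>y. 0)" for i :: 'a and c unfolding partial_def by simp
  have "gradient (\<lambda>y. u y t) x = 0" "laplacian (\<lambda>y. u y t) x = 0"
    unfolding const gradient_def laplacian_def pk by simp_all
  moreover have "time_deriv u x t - laplacian (\<lambda>y. u y t) x
      = u x t powr p + M * norm (gradient (\<lambda>y. u y t) x) powr q"
    using sol t unfolding classical_solution_def by blast
  ultimately have "time_deriv u x t = u x t powr p" by simp
  with mono[OF t, of x] have "u x t powr p \<le> 0" by simp
  then show ?thesis by (simp add: powr_eq_0_iff order_antisym[OF _ powr_ge_zero])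
qed

theorem theorem1p4:
  fixes p q M :: real
  assumes "p > 1"
    and "q = 2 * p / (p + 1)"
    and "M \<ge> M0 DIM('a::euclidean_space) p"
  shows "(\<forall>u :: 'a \<Rightarrow> real \<Rightarrow> real.
            classical_solution p q M u \<longrightarrow>
            (\<forall>x. \<forall>t<0. u x t \<ge> 0) \<longrightarrow>
            (\<forall>x. \<forall>t<0. time_deriv u x t \<le> 0) \<longrightarrow>
            (\<lambda>(x, t). u x t) \<in> o[parabolic_infinity p](parabolic_size p) \<longrightarrow>
            (\<forall>x. \<forall>t<0. u x t = 0)) \<and>
         (\<forall>u :: 'a \<Rightarrow> real \<Rightarrow> real.
            classical_solution p q M u \<longrightarrow>
            (\<forall>x. \<forall>t<0. u x t \<ge> 0) \<longrightarrow>
            (\<forall>x. \<forall>t<0. time_deriv u x t \<le> 0) \<longrightarrow>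
            bounded ((\<lambda>(x, t). u x t) ` past) \<longrightarrow>
            (\<forall>x. \<forall>t<0. u x t = 0))"
  using assms by (blast intro: ancient_solution_zero)

end
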